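(* $\mathcal{M}^{eds}$ is monotone and convex.
   Context: For a finite nonempty set $F\subset\mathbb{R}$, $\mathcal{A}(F)$ is the arithmetic mean of its elements. Definition of $\mathcal{M}^{eds}$: let $H\subset\mathbb{R}$ be bounded with at least two points, $a=\inf H$, $b=\sup H$. For $n\in\mathbb{N}$, $0\le i\le n-1$ set $H_{n,i}=H\cap[a+\frac{i}{n}(b-a),a+\frac{i+1}{n}(b-a))$ and $I_n=\{0\le i\le n-1:H_{n,i}\ne\emptyset\}$. We say $\mathcal{M}^{eds}(H)=k$ if for every $\epsilon>0$ there is $N\in\mathbb{N}$ such that for all $n>N$ and all choices $\xi_i\in H_{n,i}$ $(i\in I_n)$ we have $|\mathcal{A}(\{\xi_i:i\in I_n\})-k|<\epsilon$. $Dom(\mathcal{M}^{eds})$ is the set of $H$ for which such a $k\in\mathbb{R}$ exists. A function $\mathcal{K}$ on some bounded subsets of $\mathbb{R}$ is - monotone if $\sup H_1\le\inf H_2$ implies $\mathcal{K}(H_1)\le\mathcal{K}(H_1\cup H_2)\le\mathcal{K}(H_2)$ (for $H_1,H_2,H_1\cup H_2\in Dom(\mathcal{K})$); - convex if whenever $I$ is a closed interval, $\mathcal{K}(H)\in I$, $L\subset I$ and $H,H\cup L\in Dom(\mathcal{K})$, then $\mathcal{K}(H\cup L)\in I$. *)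

theory Defs
  imports "HOL-Analysis.Analysis"
begin

definition arith_mean :: "real set \<Rightarrow> real" where
  "arith_mean F = (\<Sum>x\<in>F. x) / real (card F)"

text \<open>
  The cells are half-open, so the supremum of \<open>H\<close> lies in no cell, even when it belongs to \<open>H\<close>.
\<close>

definition eds_cell :: "real set \<Rightarrow> nat \<Rightarrow> nat \<Rightarrow> real set" where
  "eds_cell H n i =
     H \<inter> {Inf H + real i / real n * (Sup H - Inf H) ..<
          Inf H + real (i + 1) / real n * (Sup H - Inf H)}"

definition eds_index :: "real set \<Rightarrow> nat \<Rightarrow> nat set" where
  "eds_index H n = {i. i < n \<and> eds_cell H n i \<noteq> {}}"

definition has_eds_mean :: "real set \<Rightarrow> real \<Rightarrow> bool" where
  "has_eds_mean H k \<longleftrightarrow>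
     bounded H \<and> (\<exists>x\<in>H. \<exists>y\<in>H. x \<noteq> y) \<and>
     (\<forall>\<epsilon>>0. \<exists>N. \<forall>n>N. \<forall>\<xi> :: nat \<Rightarrow> real.
        (\<forall>i\<in>eds_index H n. \<xi> i \<in> eds_cell H n i) \<longrightarrow>
        \<bar>arith_mean (\<xi> ` eds_index H n) - k\<bar> < \<epsilon>)"

definition Dom_eds :: "real set set" where
  "Dom_eds = {H. \<exists>k. has_eds_mean H k}"

definition eds_mean :: "real set \<Rightarrow> real" where
  "eds_mean H = (THE k. has_eds_mean H k)"

text \<open>
  A partial function on sets of reals is given by its domain \<open>D\<close> and a total function \<open>K\<close> that is
  only consulted on \<open>D\<close>.  The real-valued \<open>Sup\<close> and \<open>Inf\<close> below have their usual meaning when the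
  members of \<open>D\<close> are nonempty and bounded.
\<close>

definition monotone_mean :: "real set set \<Rightarrow> (real set \<Rightarrow> real) \<Rightarrow> bool" where
  "monotone_mean D K \<longleftrightarrow>
     (\<forall>H1 H2. H1 \<in> D \<and> H2 \<in> D \<and> H1 \<union> H2 \<in> D \<and> Sup H1 \<le> Inf H2 \<longrightarrow>
        K H1 \<le> K (H1 \<union> H2) \<and> K (H1 \<union> H2) \<le> K H2)"

text \<open>
  Closed intervals are taken as closed sets that are intervals, so unbounded ones are included.
\<close>

definition convex_mean :: "real set set \<Rightarrow> (real set \<Rightarrow> real) \<Rightarrow> bool" where
  "convex_mean D K \<longleftrightarrow>
     (\<forall>I H L. is_interval I \<and> closed I \<and> H \<in> D \<and> K H \<in> I \<and> L \<subseteq> I \<and> H \<union> L \<in> D \<longrightarrow>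
        K (H \<union> L) \<in> I)"

end

theory Submission
  imports Defs
begin

text \<open>
  For infinite \<open>H\<close> the mean is shown to be the limit of the barycentres of the thickenings
  \<open>\<Union>x\<in>H. {x - \<delta><..x}\<close> as \<open>\<delta>\<close> tends to 0. This limit no longer refers to the grid anchored at
  \<open>Inf H\<close> and scaled by \<open>Sup H - Inf H\<close>, so the means of \<open>H\<close> and \<open>H \<union> L\<close> can be compared: if
  \<open>L\<close> lies in a half-line that contains the mean of \<open>H\<close>, then the thickening of \<open>L\<close> cannot move the
  barycentre out of it. Monotonicity and convexity are both instances of this half-line property.

  A grid of mesh \<open>w\<close> meets an interval \<open>{s<..t}\<close> in \<open>(t - s) / w\<close> points up to sawtooth terms in \<open>s\<close>
  and \<open>t\<close>. A single grid can be atypical for \<open>H\<close>, but averaged over the meshes \<open>d / n\<close> for \<open>n\<close> in a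
  range of length comparable to its start \<open>N\<close>, the sawtooth term of an endpoint is small unless the
  endpoint is within a constant times \<open>1 / N\<close> of a rational of bounded denominator (in units of \<open>d\<close>).
  Endpoints are \<open>\<delta>\<close>-separated with \<open>\<delta>\<close> about \<open>d / N\<close>, so only boundedly many are exceptional,
  whereas the number of occupied cells tends to infinity.
\<close>

section \<open>Averages of the sawtooth function\<close>

text \<open>\<open>\<Psi>\<close> is a continuous 1-periodic primitive of the sawtooth
  \<open>frac t - 1/2\<close>. Away from integers its second-order Taylor formula is exact, with
  remainder \<open>e^2 / 2\<close>; crossing an integer, where the sawtooth jumps, costs at most
  \<open>|e|\<close> more.\<close>

lemma sawtooth_step:
  fixes t e :: real
  assumes "\<bar>e\<bar> \<le> 1"
  defines "\<Psi> \<equiv> \<lambda>t::real. ((frac t)\<^sup>2 - frac t) / 2"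
  shows "\<bar>\<Psi> (t + e) - \<Psi> t - e * (frac t - 1/2)\<bar> \<le> e\<^sup>2 / 2 + \<bar>e\<bar> * \<bar>of_int (\<lfloor>t + e\<rfloor> - \<lfloor>t\<rfloor>)\<bar>"
proof -
  define j where "j = \<lfloor>t + e\<rfloor> - \<lfloor>t\<rfloor>"
  define \<theta> where "\<theta> = frac t"
  have \<theta>: "0 \<le> \<theta>" "\<theta> < 1" unfolding \<theta>_def by (auto simp: frac_lt_1)
  have fe: "frac (t + e) = \<theta> + e - of_int j" unfolding \<theta>_def j_def frac_def by simp
  have f2: "0 \<le> \<theta> + e - of_int j" "\<theta> + e - of_int j < 1"
    using fe frac_ge_0[of "t+e"] frac_lt_1[of "t+e"] by linarith+
  have "j = 0 \<or> j = 1 \<or> j = -1" using \<theta> f2 assms(1) by linarith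
  moreover have eq: "\<Psi> (t + e) - \<Psi> t - e * (frac t - 1/2) = e\<^sup>2/2 - of_int j * (\<theta> + e) + of_int j * (of_int j + 1) / 2"
    unfolding \<Psi>_def fe \<theta>_def[symmetric] by (simp add: power2_eq_square field_simps)
  moreover have "0 \<le> e\<^sup>2" by simp
  \<comment> \<open>The extra term is \<open>1 - (\<theta> + e)\<close> for \<open>j = 1\<close> and
    \<open>\<theta> + e\<close> for \<open>j = -1\<close>: in absolute value the overshoot past the
    integer just crossed, hence at most \<open>|e|\<close>.\<close>
  moreover have "\<bar>e\<^sup>2/2 - of_int j * (\<theta> + e) + of_int j * (of_int j + 1) / 2\<bar> \<le> e\<^sup>2/2 + \<bar>e\<bar>"
    if "j = 1 \<or> j = -1" using that \<theta> f2 \<open>0 \<le> e\<^sup>2\<close>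
    by (elim disjE; simp; linarith)
  ultimately show ?thesis unfolding j_def[symmetric] eq by (elim disjE) auto
qed

text \<open>Summing \<open>sawtooth_step\<close> telescopes, so \<open>e\<close> times the sum is a
  difference of two values of \<open>\<Psi>\<close>, which oscillates by at most 1/8, up to the
  accumulated errors. The progression is monotone, so it crosses integers at most
  \<open>L * |e| + 1\<close> times. The bound follows on dividing by \<open>|e|\<close>.\<close>

lemma sawtooth_progression:
  fixes t e :: real and L :: nat
  assumes e: "\<bar>e\<bar> \<le> 1" "e \<noteq> 0"
  shows "\<bar>\<Sum>l<L. frac (t + real l * e) - 1/2\<bar> \<le> 1 / (8 * \<bar>e\<bar>) + 3/2 * real L * \<bar>e\<bar> + 1"
proof -
  define \<Psi> where "\<Psi> = (\<lambda>t::real. ((frac t)\<^sup>2 - frac t) / 2)"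
  define x where "x = (\<lambda>l::nat. t + real l * e)"
  have xS: "x (Suc l) = x l + e" for l unfolding x_def by (simp add: algebra_simps)
  have mono: "(if e > 0 then 1 else -1) * (\<lfloor>x (Suc l)\<rfloor> - \<lfloor>x l\<rfloor>) = \<bar>\<lfloor>x (Suc l)\<rfloor> - \<lfloor>x l\<rfloor>\<bar>" for l
    using floor_mono[of "x l" "x (Suc l)"] floor_mono[of "x (Suc l)" "x l"] e unfolding xS by (auto)
  have tot: "(\<Sum>l<L. \<bar>\<lfloor>x (Suc l)\<rfloor> - \<lfloor>x l\<rfloor>\<bar>) = (if e > 0 then 1 else -1) * (\<lfloor>x L\<rfloor> - \<lfloor>x 0\<rfloor>)"
    unfolding mono[symmetric] sum_distrib_left[symmetric] sum_lessThan_telescope[of "\<lambda>l. \<lfloor>x l\<rfloor>"] ..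
  have xL: "x L - x 0 = real L * e" unfolding x_def by simp
  have totb: "real_of_int (\<Sum>l<L. \<bar>\<lfloor>x (Suc l)\<rfloor> - \<lfloor>x l\<rfloor>\<bar>) \<le> real L * \<bar>e\<bar> + 1"
  proof (cases "e > 0")
    case True
    then show ?thesis unfolding tot using xL by simp linarith
  next
    case False
    then show ?thesis unfolding tot using xL by simp linarith
  qed
  have P: "-1/8 \<le> \<Psi> s" "\<Psi> s \<le> 0" for s
  proof -
    have "0 \<le> (frac s - 1/2)\<^sup>2" by simp
    then show "-1/8 \<le> \<Psi> s" unfolding \<Psi>_def by (simp add: power2_eq_square field_simps)
    have "frac s * frac s \<le> frac s * 1" by (intro mult_left_mono) (auto simp: less_imp_le frac_lt_1)
    then show "\<Psi> s \<le> 0" unfolding \<Psi>_def by (simp add: power2_eq_square field_simps)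
  qed
  have "e * (\<Sum>l<L. frac (x l) - 1/2) = (\<Psi> (x L) - \<Psi> (x 0)) - (\<Sum>l<L. \<Psi> (x l + e) - \<Psi> (x l) - e * (frac (x l) - 1/2))"
    unfolding xS[symmetric] sum_subtractf[where f="\<lambda>l. \<Psi> (x (Suc l)) - \<Psi> (x l)"]
      sum_lessThan_telescope[of "\<lambda>l. \<Psi> (x l)"] by (simp only: sum_distrib_left)
  also have "\<bar>\<dots>\<bar> \<le> 1/8 + (\<Sum>l<L. e\<^sup>2 / 2 + \<bar>e\<bar> * \<bar>of_int (\<lfloor>x l + e\<rfloor> - \<lfloor>x l\<rfloor>)\<bar>)"
  proof -
    have "\<bar>\<Sum>l<L. \<Psi> (x l + e) - \<Psi> (x l) - e * (frac (x l) - 1/2)\<bar> \<le> (\<Sum>l<L. e\<^sup>2 / 2 + \<bar>e\<bar> * \<bar>of_int (\<lfloor>x l + e\<rfloor> - \<lfloor>x l\<rfloor>)\<bar>)"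
      unfolding \<Psi>_def by (rule order_trans[OF sum_abs sum_mono], rule sawtooth_step[OF e(1)])
    then show ?thesis using P[of "x L"] P[of "x 0"] by linarith
  qed
  also have "(\<Sum>l<L. e\<^sup>2 / 2 + \<bar>e\<bar> * \<bar>of_int (\<lfloor>x l + e\<rfloor> - \<lfloor>x l\<rfloor>)\<bar>) = real L * e\<^sup>2/2 + \<bar>e\<bar> * real_of_int (\<Sum>l<L. \<bar>\<lfloor>x (Suc l)\<rfloor> - \<lfloor>x l\<rfloor>\<bar>)"
    by (simp add: sum.distrib sum_distrib_left xS)
  also have "\<dots> \<le> real L * e\<^sup>2/2 + \<bar>e\<bar> * (real L * \<bar>e\<bar> + 1)"
    using totb by (intro add_left_mono mult_left_mono) auto
  finally have "\<bar>e\<bar> * \<bar>\<Sum>l<L. frac (x l) - 1/2\<bar> \<le> 1/8 + real L * e\<^sup>2/2 + \<bar>e\<bar> * (real L * \<bar>e\<bar> + 1)"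
    by (simp add: abs_mult)
  also have "\<dots> = \<bar>e\<bar> * (1 / (8 * \<bar>e\<bar>) + 3/2 * real L * \<bar>e\<bar> + 1)"
    using e by (simp add: field_simps power2_eq_square)
  finally show ?thesis using e(2) unfolding x_def by simp
qed

text \<open>Dirichlet approximation yields \<open>p / s\<close> with \<open>s \<le> K\<close>. Along
  a residue class modulo \<open>s\<close> the numbers \<open>n * \<tau>\<close> advance modulo 1 by
  \<open>e = s * \<tau> - p\<close>, so \<open>sawtooth_progression\<close> applies to each class;
  as \<open>s\<close> divides \<open>T\<close>, all classes have the same length. The step is too
  small for cancellation only if \<open>\<tau>\<close> is within \<open>K / T\<close> of
  \<open>p / s\<close>.\<close>

lemma sawtooth_average:
  fixes K N T :: nat and \<tau> :: real
  assumes K: "0 < K" and div: "\<forall>s\<in>{1..K}. s dvd T" and T: "K * K \<le> T"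
  obtains s :: nat and p :: int where "0 < s" "s \<le> K" "\<bar>\<tau> - p / s\<bar> < 1"
    "\<bar>\<tau> - p / s\<bar> < K / T \<or> \<bar>\<Sum>n=N..<N+T. frac (real n * \<tau>) - 1/2\<bar> \<le> 3 * T / K"
proof -
  obtain p :: int and s :: nat where s: "0 < s" "s \<le> K" and ap: "\<bar>of_int (int s) * \<tau> - of_int p\<bar> < 1 / K"
  proof -
    obtain h k where "0 < k" "k \<le> int K" "\<bar>of_int k * \<tau> - of_int h\<bar> < 1 / K"
      using Dirichlet_approx[OF K, of \<tau>] by metis
    then show ?thesis by (intro that[of "nat k" h]) auto
  qed
  define e where "e = real s * \<tau> - of_int p"
  have e: "\<bar>e\<bar> < 1 / K" using ap unfolding e_def by simp
  have K1: "1 / real K \<le> 1" using K by simp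
  have es: "\<tau> - p / s = e / s" using s unfolding e_def by (simp add: field_simps)
  have "\<bar>e / s\<bar> \<le> \<bar>e\<bar>" using s by (simp add: divide_le_eq mult_le_cancel_left1)
  then have lt1: "\<bar>\<tau> - p / s\<bar> < 1" using e K1 unfolding es by linarith
  obtain L where L: "T = L * s" using bspec[OF div, of s] s by (auto simp: dvd_def mult.commute)
  have Tp: "0 < T" using T K by (metis gr0I mult_is_0 not_le)
  show thesis
  proof (cases "\<bar>\<tau> - p / s\<bar> < K / T")
    case True
    then show ?thesis using that s lt1 by blast
  next
    case False
    then have big: "K / T \<le> \<bar>e\<bar> / s" unfolding es by simp
    then have e0: "e \<noteq> 0" using K Tp s by (intro notI) (simp add: divide_le_0_iff)
    have "(\<Sum>n=N..<N+T. frac (real n * \<tau>) - 1/2) = (\<Sum>n<L * s. frac (real (N + n) * \<tau>) - 1/2)"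
      using sum.shift_bounds_nat_ivl[of "\<lambda>n. frac (real n * \<tau>) - 1/2" 0 N "L * s"]
      unfolding L by (simp add: add.commute atLeast0LessThan)
    also have "\<dots> = (\<Sum>l<L. \<Sum>n\<in>{l * s..<l * s+s}. frac (real (N + n) * \<tau>) - 1/2)"
      by (rule sum.nat_group[symmetric])
    also have "\<dots> = (\<Sum>l<L. \<Sum>r<s. frac (real (N + (r + l * s)) * \<tau>) - 1/2)"
    proof (rule sum.cong[OF refl])
      fix l
      show "(\<Sum>n\<in>{l * s..<l * s+s}. frac (real (N + n) * \<tau>) - 1/2) = (\<Sum>r<s. frac (real (N + (r + l * s)) * \<tau>) - 1/2)"
        using sum.shift_bounds_nat_ivl[of "\<lambda>n. frac (real (N + n) * \<tau>) - 1/2" 0 "l * s" s]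
        by (simp only: add_0 add.commute[of s] atLeast0LessThan)
    qed
    also have "\<dots> = (\<Sum>r<s. \<Sum>l<L. frac (real (N + (r + l * s)) * \<tau>) - 1/2)"
      by (rule sum.swap)
    also have "\<dots> = (\<Sum>r<s. \<Sum>l<L. frac (real (N + r) * \<tau> + real l * e) - 1/2)"
    proof (intro sum.cong refl)
      fix r l
      \<comment> \<open>The summand \<open>l * p\<close> is an integer and disappears under
        \<open>frac\<close>.\<close>
      have "real (N + (r + l * s)) * \<tau> = real (N + r) * \<tau> + real l * e + of_int (int l * p)"
        unfolding e_def by (simp add: algebra_simps)
      then show "frac (real (N + (r + l * s)) * \<tau>) - 1/2 = frac (real (N + r) * \<tau> + real l * e) - 1/2"
        by (metis frac_def add_diff_add diff_self add.right_neutral floor_add_int of_int_add)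
    qed
    also have "\<bar>\<dots>\<bar> \<le> (\<Sum>r<s. 1 / (8 * \<bar>e\<bar>) + 3/2 * real L * \<bar>e\<bar> + 1)"
      by (rule order_trans[OF sum_abs sum_mono], rule sawtooth_progression) (use e e0 K1 in auto)
    also have "\<dots> = (s / \<bar>e\<bar>) / 8 + 3/2 * T * \<bar>e\<bar> + s"
      unfolding L by (simp add: algebra_simps)
    \<comment> \<open>The three terms are bounded in turn by \<open>|e| / s \<ge> K / T\<close>, by
      \<open>|e| < 1 / K\<close> and by \<open>s * K \<le> T\<close>.\<close>
    also have "\<dots> \<le> (T / K) / 8 + 3/2 * T * (1/K) + T / K"
    proof (intro add_mono mult_left_mono divide_right_mono)
      show "s / \<bar>e\<bar> \<le> T / K" using big K Tp s e0 by (simp add: field_simps)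
      show "\<bar>e\<bar> \<le> 1 / K" using e by simp
      have "s * K \<le> K * K" using s by simp
      then have "s * K \<le> T" using T by linarith
      then show "real s \<le> T / K" using K by (simp add: pos_le_divide_eq flip: of_nat_mult)
    qed auto
    also have "\<dots> \<le> 3 * T / K" using K by (simp add: field_simps)
    finally show ?thesis using that s lt1 by blast
  qed
qed

section \<open>Thickenings of finite sets\<close>

text \<open>The intervals are open on the left to match the half-open cells: a grid point
  \<open>y\<close> lies in \<open>thick F w\<close> exactly if the cell \<open>{y..<y + w}\<close>
  meets \<open>F\<close>. Counting occupied cells thus becomes counting grid points in a
  thickening.\<close>

definition thick :: "real set \<Rightarrow> real \<Rightarrow> real set" where
  "thick F \<delta> = (\<Union>x\<in>F. {x - \<delta><..x})"

text \<open>For finite \<open>F\<close> and positive \<open>\<delta>\<close>, the components of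
  \<open>thick F \<delta>\<close> are the intervals \<open>{x - \<delta><..y}\<close> with
  \<open>x\<close> a left end and \<open>y\<close> the first right end from \<open>x\<close> on.
  Points at distance exactly \<open>\<delta>\<close> share a component, because their half-open
  intervals abut.\<close>

definition right_ends :: "real set \<Rightarrow> real \<Rightarrow> real set" where
  "right_ends F \<delta> = {x \<in> F. F \<inter> {x<..x + \<delta>} = {}}"

definition left_ends :: "real set \<Rightarrow> real \<Rightarrow> real set" where
  "left_ends F \<delta> = {x \<in> F. F \<inter> {x - \<delta>..<x} = {}}"

lemma thick_iff: "y \<in> thick F \<delta> \<longleftrightarrow> F \<inter> {y..<y + \<delta>} \<noteq> {}"
  unfolding thick_def by force

lemma thick_mono: "F \<subseteq> G \<Longrightarrow> thick F \<delta> \<subseteq> thick G \<delta>"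
  unfolding thick_def by blast

lemma thick_subset: "F \<subseteq> {a..b} \<Longrightarrow> thick F \<delta> \<subseteq> {a - \<delta>..b}"
  unfolding thick_def by force

lemma thick_borel [measurable]: "finite F \<Longrightarrow> thick F \<delta> \<in> sets borel"
  unfolding thick_def by (intro sets.finite_UN) auto

lemma thick_bounded: "finite F \<Longrightarrow> bounded (thick F \<delta>)"
  unfolding thick_def by (intro bounded_UN) auto

text \<open>Whatever \<open>{b - \<delta><..b}\<close> contains up to \<open>Max F\<close> is
  already covered by \<open>{Max F - \<delta><..Max F}\<close>, so a new maximum adds only the piece
  above both \<open>b - \<delta>\<close> and \<open>Max F\<close>. Inductions that insert the points
  in increasing order can then use additivity.\<close>

lemma thick_insert_Max:
  assumes F: "finite F" "F \<noteq> {}" and b: "\<forall>x\<in>F. x < b" and "0 < \<delta>"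
  shows "thick (insert b F) \<delta> = thick F \<delta> \<union> {max (b - \<delta>) (Max F)<..b}"
    and "thick F \<delta> \<inter> {max (b - \<delta>) (Max F)<..b} = {}"
proof -
  have m: "Max F \<in> F" "\<And>x. x \<in> F \<Longrightarrow> x \<le> Max F" using F by auto
  have "y \<le> Max F" if y: "y \<in> thick F \<delta>" for y
  proof -
    obtain x where "x \<in> F" "y \<le> x" using y unfolding thick_def by auto
    then show ?thesis using m(2) order_trans by blast
  qed
  then show "thick F \<delta> \<inter> {max (b - \<delta>) (Max F)<..b} = {}" by (auto simp: disjoint_iff not_less)
  have "{b - \<delta><..b} \<subseteq> thick F \<delta> \<union> {max (b - \<delta>) (Max F)<..b}"
  proof
    fix y assume y: "y \<in> {b - \<delta><..b}"
    show "y \<in> thick F \<delta> \<union> {max (b - \<delta>) (Max F)<..b}"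
    proof (cases "Max F < y")
      case False
      then have "y \<in> {Max F - \<delta><..Max F}" using y bspec[OF b m(1)] by auto
      then show ?thesis using m(1) unfolding thick_def by blast
    qed (use y in auto)
  qed
  moreover have "{max (b - \<delta>) (Max F)<..b} \<subseteq> {b - \<delta><..b}" by auto
  moreover have "thick (insert b F) \<delta> = {b - \<delta><..b} \<union> thick F \<delta>" unfolding thick_def by simp
  ultimately show "thick (insert b F) \<delta> = thick F \<delta> \<union> {max (b - \<delta>) (Max F)<..b}" by blast
qed

text \<open>Only the old maximum can change its status: it stops being a right end when
  \<open>b\<close> comes within \<open>\<delta>\<close> of it.\<close>

lemma right_ends_insert:
  assumes F: "finite F" "F \<noteq> {}" and b: "\<forall>x\<in>F. x < b" and \<delta>: "0 < \<delta>"
  shows "right_ends (insert b F) \<delta> = insert b (if b - Max F \<le> \<delta> then right_ends F \<delta> - {Max F} else right_ends F \<delta>)"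
    and "Max F \<in> right_ends F \<delta>"
proof -
  have m: "Max F \<in> F" "\<And>x. x \<in> F \<Longrightarrow> x \<le> Max F" using F by auto
  have "y \<notin> {Max F<..Max F + \<delta>}" if "y \<in> F" for y using m(2)[OF that] by auto
  then show "Max F \<in> right_ends F \<delta>" using m(1) unfolding right_ends_def by blast
  have "y \<notin> {b<..b + \<delta>}" if "y \<in> F" for y using bspec[OF b that] by auto
  then have "b \<in> right_ends (insert b F) \<delta>" unfolding right_ends_def by auto
  moreover have "x \<in> right_ends (insert b F) \<delta> \<longleftrightarrow> x \<in> right_ends F \<delta> \<and> x + \<delta> < b" if x: "x \<in> F" for x
    using bspec[OF b x] x unfolding right_ends_def by auto
  moreover have "x + \<delta> < b \<longleftrightarrow> (b - Max F \<le> \<delta> \<longrightarrow> x \<noteq> Max F)" if x: "x \<in> right_ends F \<delta>" for x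
  proof -
    have xF: "x \<in> F" and "Max F \<notin> {x<..x + \<delta>}" using x m(1) unfolding right_ends_def by blast+
    then show ?thesis using m(2)[OF xF] bspec[OF b m(1)] by auto
  qed
  moreover have "right_ends (insert b F) \<delta> \<subseteq> insert b F" "right_ends F \<delta> \<subseteq> F"
    unfolding right_ends_def by blast+
  ultimately show "right_ends (insert b F) \<delta> = insert b (if b - Max F \<le> \<delta> then right_ends F \<delta> - {Max F} else right_ends F \<delta>)"
    by (intro set_eqI) (smt (verit, best) Diff_iff insert_iff singletonD subsetD)
qed

lemma left_ends_insert:
  assumes F: "finite F" "F \<noteq> {}" and b: "\<forall>x\<in>F. x < b" and "0 < \<delta>"
  shows "left_ends (insert b F) \<delta> = (if b - Max F \<le> \<delta> then left_ends F \<delta> else insert b (left_ends F \<delta>))"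
proof -
  have m: "Max F \<in> F" "\<And>x. x \<in> F \<Longrightarrow> x \<le> Max F" using F by auto
  have nb: "b \<notin> {x - \<delta>..<x}" if "x \<in> F" for x using bspec[OF b that] by auto
  have "left_ends (insert b F) \<delta> = left_ends F \<delta> \<union> {y. y = b \<and> F \<inter> {b - \<delta>..<b} = {}}"
    unfolding left_ends_def using nb bspec[OF b] by auto
  moreover have "F \<inter> {b - \<delta>..<b} = {} \<longleftrightarrow> \<not> b - Max F \<le> \<delta>"
  proof
    assume "F \<inter> {b - \<delta>..<b} = {}"
    then have "Max F \<notin> {b - \<delta>..<b}" using m(1) by blast
    then show "\<not> b - Max F \<le> \<delta>" using bspec[OF b m(1)] by auto
  next
    assume "\<not> b - Max F \<le> \<delta>"
    then have "x \<notin> {b - \<delta>..<b}" if "x \<in> F" for x using m(2)[OF that] by auto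
    then show "F \<inter> {b - \<delta>..<b} = {}" by blast
  qed
  ultimately show ?thesis by auto
qed

lemma finite_ends: "finite F \<Longrightarrow> finite (right_ends F \<delta>)" "finite F \<Longrightarrow> finite (left_ends F \<delta>)"
  unfolding right_ends_def left_ends_def by auto

lemma ends_subset: "right_ends F \<delta> \<subseteq> F" "left_ends F \<delta> \<subseteq> F"
  unfolding right_ends_def left_ends_def by auto

text \<open>Consecutive points at distance at most \<open>\<delta>\<close> contribute a telescoping sum, so only the
  endpoints of the components remain.\<close>

lemma additive_thick:
  fixes \<Lambda> :: "real set \<Rightarrow> real"
  assumes F: "finite F" and \<delta>: "0 < \<delta>"
    and empty: "\<Lambda> {} = 0"
    and add: "\<And>A B. \<lbrakk>bounded A; bounded B; A \<in> sets borel; B \<in> sets borel; A \<inter> B = {}\<rbrakk> \<Longrightarrow> \<Lambda> (A \<union> B) = \<Lambda> A + \<Lambda> B"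
    and ivl: "\<And>s t. s \<le> t \<Longrightarrow> \<Lambda> {s<..t} = \<Phi> t - \<Phi> s"
  shows "\<Lambda> (thick F \<delta>) = (\<Sum>x\<in>right_ends F \<delta>. \<Phi> x) - (\<Sum>x\<in>left_ends F \<delta>. \<Phi> (x - \<delta>))"
  using F
proof (induction F rule: finite_linorder_max_induct)
  case empty
  then show ?case using assms(3) by (simp add: thick_def right_ends_def left_ends_def)
next
  case (insert b F)
  show ?case
  proof (cases "F = {}")
    case True
    have "right_ends {b} \<delta> = {b}" "left_ends {b} \<delta> = {b}"
      unfolding right_ends_def left_ends_def by auto
    moreover have "thick {b} \<delta> = {b - \<delta><..b}" unfolding thick_def by simp
    ultimately show ?thesis using True ivl[of "b - \<delta>" b] \<delta> by simp
  next
    case False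
    have b: "\<forall>x\<in>F. x < b" using insert by auto
    let ?m = "Max F"
    have m: "?m < b" "b \<notin> F" using b insert.hyps(1) False by auto
    have "\<Lambda> (thick (insert b F) \<delta>) = \<Lambda> (thick F \<delta>) + \<Lambda> {max (b - \<delta>) ?m<..b}"
      unfolding thick_insert_Max(1)[OF insert.hyps(1) False b \<delta>]
      by (rule add) (use thick_insert_Max(2)[OF insert.hyps(1) False b \<delta>] insert.hyps(1) in \<open>auto intro: thick_bounded\<close>)
    also have "\<Lambda> {max (b - \<delta>) ?m<..b} = \<Phi> b - \<Phi> (max (b - \<delta>) ?m)"
      using m \<delta> by (intro ivl) auto
    finally have L: "\<Lambda> (thick (insert b F) \<delta>) = \<Lambda> (thick F \<delta>) + \<Phi> b - \<Phi> (max (b - \<delta>) ?m)" by simp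
    note fin = finite_ends[OF insert.hyps(1), of \<delta>]
    have nb: "b \<notin> right_ends F \<delta>" "b \<notin> left_ends F \<delta>" using ends_subset[of F \<delta>] m by auto
    note R = right_ends_insert(1)[OF insert.hyps(1) False b \<delta>]
      and L' = left_ends_insert[OF insert.hyps(1) False b \<delta>]
    show ?thesis
    \<comment> \<open>If \<open>b\<close> is within \<open>\<delta>\<close> of \<open>?m\<close>,
      the last component is prolonged and \<open>\<Phi> ?m\<close> gives way to
      \<open>\<Phi> b\<close>; otherwise a new component begins at
      \<open>b - \<delta>\<close>.\<close>
    proof (cases "b - ?m \<le> \<delta>")
      case True
      have "(\<Sum>x\<in>right_ends (insert b F) \<delta>. \<Phi> x) = \<Phi> b + ((\<Sum>x\<in>right_ends F \<delta>. \<Phi> x) - \<Phi> ?m)"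
        unfolding R using True fin nb right_ends_insert(2)[OF insert.hyps(1) False b \<delta>] by (simp add: sum_diff1)
      moreover have "max (b - \<delta>) ?m = ?m" using True by simp
      ultimately show ?thesis unfolding L insert.IH L' using True by simp
    next
      case False
      have "(\<Sum>x\<in>right_ends (insert b F) \<delta>. \<Phi> x) = \<Phi> b + (\<Sum>x\<in>right_ends F \<delta>. \<Phi> x)"
        "(\<Sum>x\<in>left_ends (insert b F) \<delta>. \<Phi> (x - \<delta>)) = \<Phi> (b - \<delta>) + (\<Sum>x\<in>left_ends F \<delta>. \<Phi> (x - \<delta>))"
        unfolding R L' using False fin nb by simp_all
      moreover have "max (b - \<delta>) ?m = b - \<delta>" using False by simp
      ultimately show ?thesis unfolding L insert.IH by simp
    qed
  qed
qed

section \<open>Integrals of affine functions and measures of thickenings\<close>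

lemma affine_set_integrable:
  fixes u v :: real
  assumes "bounded A" "A \<in> sets borel"
  shows "set_integrable lborel A (\<lambda>x. u + v * x)"
proof -
  obtain c where "A \<subseteq> {-c..c}" using bounded_subset_cbox_symmetric[OF assms(1)] by (metis cbox_interval)
  moreover have "set_integrable lborel {-c..c} (\<lambda>x. u + v * x)"
    by (intro borel_integrable_atLeastAtMost' continuous_intros)
  ultimately show ?thesis using assms(2) by (intro set_integrable_subset[of _ "{-c..c}" _ A]) simp_all
qed

lemma LINT_half_open:
  fixes u v :: real
  assumes "s \<le> t"
  shows "(LINT x:{s<..t}|lborel. u + v * x) = (u * t + v * t\<^sup>2 / 2) - (u * s + v * s\<^sup>2 / 2)"
proof -
  have "(LINT x:{s<..t}|lborel. u + v * x) = integral {s<..t} (\<lambda>x. u + v * x)"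
    by (rule set_borel_integral_eq_integral(2)[OF affine_set_integrable]) auto
  also have "\<dots> = integral {s..t} (\<lambda>x. u + v * x)"
  proof (rule integral_subset_negligible)
    have "{s..t} - {s<..t} \<subseteq> {s}" by auto
    then show "negligible ({s..t} - {s<..t})" using negligible_sing negligible_subset by blast
  qed auto
  also have "((\<lambda>x. u + v * x) has_integral (u * t + v * t\<^sup>2 / 2) - (u * s + v * s\<^sup>2 / 2)) {s..t}"
  proof (rule fundamental_theorem_of_calculus[OF assms])
    fix x :: real
    have "((\<lambda>x. u * x + v * x\<^sup>2 / 2) has_real_derivative u + v * x) (at x within {s..t})"
      by (auto intro!: derivative_eq_intros)
    then show "((\<lambda>x. u * x + v * x\<^sup>2 / 2) has_vector_derivative u + v * x) (at x within {s..t})"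
      by (simp add: has_real_derivative_iff_has_vector_derivative)
  qed
  then have "integral {s..t} (\<lambda>x. u + v * x) = (u * t + v * t\<^sup>2 / 2) - (u * s + v * s\<^sup>2 / 2)" by (rule integral_unique)
  finally show ?thesis .
qed

lemma LINT_affine_Un:
  fixes u v :: real
  assumes "bounded A" "bounded B" "A \<in> sets borel" "B \<in> sets borel" "A \<inter> B = {}"
  shows "(LINT x:A \<union> B|lborel. u + v * x) = (LINT x:A|lborel. u + v * x) + (LINT x:B|lborel. u + v * x)"
  by (intro set_integral_Un affine_set_integrable assms)

lemma LINT_one: "(LINT x:A|lborel. 1) = measure lborel (A :: real set)"
  by (simp add: set_lebesgue_integral_def)

lemma measure_Un_bounded:
  fixes A B :: "real set"
  assumes "bounded A" "bounded B" "A \<in> sets borel" "B \<in> sets borel" "A \<inter> B = {}"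
  shows "measure lborel (A \<union> B) = measure lborel A + measure lborel B"
  by (rule measure_Union) (use assms less_imp_neq[OF emeasure_bounded_finite] in auto)

lemma measure_mono_bounded:
  fixes A B :: "real set"
  assumes "A \<subseteq> B" "bounded B" "A \<in> sets borel" "B \<in> sets borel"
  shows "measure lborel A \<le> measure lborel B"
proof (rule measure_mono_fmeasurable)
  show "B \<in> fmeasurable lborel" using assms emeasure_bounded_finite[of B] by (intro fmeasurableI) auto
qed (use assms in auto)

text \<open>The intervals of length \<open>\<delta>\<close> that end at the points of
  \<open>S\<close> are disjoint: each point of \<open>S\<close> is both a left and a right end of
  \<open>S\<close>. This bounds the number of endpoints of components by the measure over
  \<open>\<delta>\<close>, and it makes the measure large in units of \<open>\<delta>\<close> once
  \<open>H\<close> supplies many separated points.\<close>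

lemma measure_thick_ge:
  fixes \<delta> :: real
  assumes F: "finite F" and \<delta>: "0 < \<delta>" and S: "S \<subseteq> F" and sep: "\<And>x y. \<lbrakk>x \<in> S; y \<in> S; x < y\<rbrakk> \<Longrightarrow> \<delta> < y - x"
  shows "card S * \<delta> \<le> measure lborel (thick F \<delta>)"
proof -
  have fS: "finite S" using F S finite_subset by blast
  have e: "right_ends S \<delta> = S" "left_ends S \<delta> = S"
  proof -
    have "y \<notin> {x<..x + \<delta>}" "y \<notin> {x - \<delta>..<x}" if "x \<in> S" "y \<in> S" for x y
      using sep[OF that] sep[OF that(2,1)] by auto
    then show "right_ends S \<delta> = S" "left_ends S \<delta> = S" unfolding right_ends_def left_ends_def by blast+
  qed
  have "measure lborel (thick S \<delta>) = (\<Sum>x\<in>S. x) - (\<Sum>x\<in>S. x - \<delta>)"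
    by (subst additive_thick[OF fS \<delta>, of "measure lborel" "\<lambda>x. x"]) (auto simp: measure_Un_bounded e)
  also have "\<dots> = card S * \<delta>" by (simp add: sum_subtractf)
  finally show ?thesis
    using measure_mono_bounded[OF thick_mono[OF S, of \<delta>]] F fS thick_bounded by auto
qed

lemma ends_separated:
  assumes "x < y"
  shows "x \<in> right_ends F \<delta> \<Longrightarrow> y \<in> right_ends F \<delta> \<Longrightarrow> \<delta> < y - x"
    and "x \<in> left_ends F \<delta> \<Longrightarrow> y \<in> left_ends F \<delta> \<Longrightarrow> \<delta> < y - x"
proof -
  show "\<delta> < y - x" if "x \<in> right_ends F \<delta>" "y \<in> right_ends F \<delta>"
  proof -
    have "y \<notin> {x<..x + \<delta>}" using that unfolding right_ends_def by blast
    then show ?thesis using assms by auto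
  qed
  show "\<delta> < y - x" if "x \<in> left_ends F \<delta>" "y \<in> left_ends F \<delta>"
  proof -
    have "x \<notin> {y - \<delta>..<y}" using that unfolding left_ends_def by blast
    then show ?thesis using assms by auto
  qed
qed

lemma card_ends:
  fixes \<delta> :: real
  assumes "finite F" "0 < \<delta>"
  shows "card (right_ends F \<delta>) * \<delta> \<le> measure lborel (thick F \<delta>)"
    and "card (left_ends F \<delta>) * \<delta> \<le> measure lborel (thick F \<delta>)"
  by (rule measure_thick_ge[OF assms ends_subset(1)], erule (2) ends_separated(1)[rotated])
    (rule measure_thick_ge[OF assms ends_subset(2)], erule (2) ends_separated(2)[rotated])

text \<open>A new maximum adds \<open>min \<eta> (b - Max F)\<close> to the measure. This is concave
  in the radius \<open>\<eta>\<close> and vanishes at 0, so shrinking the radius by a factor shrinks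
  the measure by no more than that factor.\<close>

lemma measure_thick_scale:
  assumes F: "finite F" and \<delta>: "0 < \<delta>'" "\<delta>' \<le> \<delta>"
  shows "\<delta>' / \<delta> * measure lborel (thick F \<delta>) \<le> measure lborel (thick F \<delta>')"
  using F
proof (induction F rule: finite_linorder_max_induct)
  case empty
  then show ?case by (simp add: thick_def)
next
  case (insert b F)
  show ?case
  proof (cases "F = {}")
    case True
    then show ?thesis using \<delta> by (simp add: thick_def)
  next
    case False
    have b: "\<forall>x\<in>F. x < b" using insert by auto
    let ?m = "Max F"
    have m: "?m < b" using b insert.hyps(1) False by auto
    have eq: "measure lborel (thick (insert b F) \<eta>) = measure lborel (thick F \<eta>) + min \<eta> (b - ?m)" if "0 < \<eta>" for \<eta>
      unfolding thick_insert_Max(1)[OF insert.hyps(1) False b that]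
      by (subst measure_Un_bounded)
         (use thick_insert_Max(2)[OF insert.hyps(1) False b that] insert.hyps(1) m that in \<open>auto intro: thick_bounded simp: max_def min_def\<close>)
    have "\<delta>' / \<delta> * min \<delta> (b - ?m) \<le> min \<delta>' (b - ?m)"
    proof (rule min.boundedI)
      have "\<delta>' / \<delta> * min \<delta> (b - ?m) \<le> \<delta>' / \<delta> * \<delta>" using \<delta> by (intro mult_left_mono) auto
      then show "\<delta>' / \<delta> * min \<delta> (b - ?m) \<le> \<delta>'" using \<delta> by simp
      have "\<delta>' / \<delta> * min \<delta> (b - ?m) \<le> 1 * (b - ?m)" using \<delta> m by (intro mult_mono) auto
      then show "\<delta>' / \<delta> * min \<delta> (b - ?m) \<le> b - ?m" by simp
    qed
    then show ?thesis using insert.IH \<delta> eq[of \<delta>] eq[of \<delta>'] by (simp only: distrib_left add_mono)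
  qed
qed

section \<open>Grid points in a thickening\<close>

text \<open>The index runs over the integers, as a thickening may reach below the anchor
  \<open>a\<close>.\<close>

definition grid_sum :: "real \<Rightarrow> real \<Rightarrow> (real \<Rightarrow> real) \<Rightarrow> real set \<Rightarrow> real" where
  "grid_sum a w f U = (\<Sum>i | a + real_of_int i * w \<in> U. f (a + real_of_int i * w))"

lemma finite_grid:
  assumes "bounded U" "0 < w"
  shows "finite {i. a + real_of_int i * w \<in> U}"
proof -
  obtain c where c: "U \<subseteq> {-c..c}" using bounded_subset_cbox_symmetric[OF assms(1)] by (metis cbox_interval)
  have "i \<in> {\<lfloor>(-c - a) / w\<rfloor>..\<lceil>(c - a) / w\<rceil>}" if "a + real_of_int i * w \<in> U" for i
  proof -
    have "-c \<le> a + i * w" "a + i * w \<le> c" using c that by auto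
    then have "(-c - a) / w \<le> i" "i \<le> (c - a) / w"
      using assms(2) by (simp_all add: pos_divide_le_eq pos_le_divide_eq)
    then show ?thesis by (simp add: floor_le_iff le_ceiling_iff)
  qed
  then have "{i. a + real_of_int i * w \<in> U} \<subseteq> {\<lfloor>(-c - a) / w\<rfloor>..\<lceil>(c - a) / w\<rceil>}" by blast
  then show ?thesis using finite_atLeastAtMost_int finite_subset by blast
qed

lemma grid_sum_Un:
  assumes "bounded A" "bounded B" "A \<inter> B = {}" "0 < w"
  shows "grid_sum a w f (A \<union> B) = grid_sum a w f A + grid_sum a w f B"
proof -
  have "{i. a + real_of_int i * w \<in> A \<union> B} = {i. a + real_of_int i * w \<in> A} \<union> {i. a + real_of_int i * w \<in> B}" by auto
  moreover have "{i. a + real_of_int i * w \<in> A} \<inter> {i. a + real_of_int i * w \<in> B} = {}" using assms(3) by auto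
  ultimately show ?thesis unfolding grid_sum_def using finite_grid assms by (simp add: sum.union_disjoint)
qed

text \<open>This is the boundary term of the Euler-Maclaurin formula for the affine function
  \<open>u + v * x\<close>: the first Bernoulli polynomial goes with the value at \<open>t\<close>,
  the second, up to its constant, with the slope.\<close>

definition grid_defect :: "real \<Rightarrow> real \<Rightarrow> real \<Rightarrow> real \<Rightarrow> real \<Rightarrow> real" where
  "grid_defect a w u v t = v * w * ((frac ((t - a) / w))\<^sup>2 - frac ((t - a) / w)) / 2
     - (u + v * t) * (frac ((t - a) / w) - 1/2)"

lemma sum_int_affine:
  fixes u v :: real and p q :: int
  assumes "p \<le> q"
  shows "(\<Sum>i\<in>{p<..q}. u + v * i) = (u * q + v * q * (q + 1) / 2) - (u * p + v * p * (p + 1) / 2)"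
  using assms
proof (induction q rule: int_ge_induct)
  case (step q)
  have "{p<..q + 1} = insert (q + 1) {p<..q}" using step by auto
  then show ?case using step by (simp add: field_simps)
qed simp

text \<open>Sum and integral both have explicit primitives, the former evaluated at the floor of the
  grid coordinate. Their difference at \<open>t\<close> is \<open>grid_defect\<close> up to a
  constant that cancels between \<open>s\<close> and \<open>t\<close>.\<close>

lemma grid_sum_half_open:
  assumes w: "0 < w" and st: "s \<le> t"
  shows "grid_sum a w (\<lambda>x. u + v * x) {s<..t} - (LINT x:{s<..t}|lborel. u + v * x) / w
    = grid_defect a w u v t - grid_defect a w u v s"
proof -
  define P where "P = (\<lambda>t. \<lfloor>(t - a) / w\<rfloor>)"
  have mem: "{i. a + real_of_int i * w \<in> {s<..t}} = {P s<..P t}"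
  proof -
    have "s < a + real_of_int i * w \<longleftrightarrow> P s < i" "a + real_of_int i * w \<le> t \<longleftrightarrow> i \<le> P t" for i
      using w unfolding P_def by (auto simp: floor_less_iff le_floor_iff field_simps)
    then show ?thesis by auto
  qed
  have "P s \<le> P t" unfolding P_def using w st by (intro floor_mono divide_right_mono) auto
  then have G: "grid_sum a w (\<lambda>x. u + v * x) {s<..t}
    = ((u + v * a) * P t + v * w * P t * (P t + 1) / 2) - ((u + v * a) * P s + v * w * P s * (P s + 1) / 2)"
    unfolding grid_sum_def mem using sum_int_affine[of "P s" "P t" "u + v * a" "v * w"] by (simp add: algebra_simps)
  have D: "grid_defect a w u v t = ((u + v * a) * P t + v * w * P t * (P t + 1) / 2) - (u * t + v * t\<^sup>2 / 2) / w
       + ((u + v * a) / 2 + (u * a + v * a\<^sup>2 / 2) / w)" for t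
  proof -
    define y where "y = (t - a) / w"
    have t: "t = a + w * y" unfolding y_def using w by simp
    have Py: "of_int (P t) = y - frac y" unfolding P_def y_def frac_def by simp
    show ?thesis unfolding grid_defect_def y_def[symmetric] of_int_add of_int_1 Py
      unfolding t using w by (simp add: field_simps power2_eq_square)
  qed
  show ?thesis unfolding G D LINT_half_open[OF st] by (simp add: diff_divide_distrib)
qed

lemma grid_sum_thick:
  assumes F: "finite F" and \<delta>: "0 < \<delta>" and w: "0 < w"
  shows "grid_sum a w (\<lambda>x. u + v * x) (thick F \<delta>) - (LINT x:thick F \<delta>|lborel. u + v * x) / w
    = (\<Sum>x\<in>right_ends F \<delta>. grid_defect a w u v x) - (\<Sum>x\<in>left_ends F \<delta>. grid_defect a w u v (x - \<delta>))"
proof (rule additive_thick[OF F \<delta>, where \<Lambda> = "\<lambda>U. grid_sum a w (\<lambda>x. u + v * x) U - (LINT x:U|lborel. u + v * x) / w"])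
  show "grid_sum a w (\<lambda>x. u + v * x) {} - (LINT x:{}|lborel. u + v * x) / w = 0"
    by (simp add: grid_sum_def set_lebesgue_integral_def)
qed (simp_all add: grid_sum_Un w LINT_affine_Un add_divide_distrib grid_sum_half_open)

text \<open>For mesh \<open>d / n\<close> the grid coordinate of \<open>t\<close> is
  \<open>n\<close> times \<open>(t - a) / d\<close>, so the leading terms of the defects form a
  sawtooth sum. The remaining term is of the order of the mesh, as
  \<open>\<theta>^2 - \<theta>\<close> is at most 1/4 in absolute value.\<close>

lemma grid_defect_sum:
  assumes d: "0 < d" and N: "0 < N"
  shows "\<bar>\<Sum>n=N..<N+T. grid_defect a (d / real n) u v t\<bar>
    \<le> \<bar>u + v * t\<bar> * \<bar>\<Sum>n=N..<N+T. frac (real n * ((t - a) / d)) - 1/2\<bar> + T * (\<bar>v\<bar> * d / (8 * N))"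
proof -
  have eq: "(t - a) / (d / real n) = real n * ((t - a) / d)" for n using d by simp
  define q where "q = (\<lambda>n. v * (d / real n) * ((frac (real n * ((t - a) / d)))\<^sup>2 - frac (real n * ((t - a) / d))) / 2)"
  have q: "\<bar>q n\<bar> \<le> \<bar>v\<bar> * d / (8 * N)" if "n \<in> {N..<N+T}" for n
  proof -
    define \<theta> where "\<theta> = frac (real n * ((t - a) / d))"
    have th: "0 \<le> \<theta>" "\<theta> < 1" unfolding \<theta>_def by (auto simp: frac_lt_1)
    have "0 \<le> (\<theta> - 1/2)\<^sup>2" by simp
    moreover have "\<theta> * \<theta> \<le> \<theta> * 1" using th by (intro mult_left_mono) auto
    ultimately have "\<bar>\<theta>\<^sup>2 - \<theta>\<bar> \<le> 1/4" by (simp add: power2_eq_square field_simps)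
    moreover have "d / n \<le> d / N" using that N d by (intro divide_left_mono) auto
    ultimately have "\<bar>v\<bar> * (d / n) * \<bar>\<theta>\<^sup>2 - \<theta>\<bar> / 2 \<le> \<bar>v\<bar> * (d / N) * (1/4) / 2"
      using d by (intro divide_right_mono mult_mono mult_left_mono) auto
    then show ?thesis unfolding q_def \<theta>_def[symmetric] using d by (simp add: abs_mult)
  qed
  have "(\<Sum>n=N..<N+T. grid_defect a (d / real n) u v t)
     = (\<Sum>n=N..<N+T. q n) - (u + v * t) * (\<Sum>n=N..<N+T. frac (real n * ((t - a) / d)) - 1/2)"
    unfolding grid_defect_def eq q_def sum_distrib_left sum_subtractf[symmetric] ..
  moreover have "\<bar>\<Sum>n=N..<N+T. q n\<bar> \<le> T * (\<bar>v\<bar> * d / (8 * N))"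
    using order_trans[OF sum_abs[of q "{N..<N+T}"] sum_bounded_above[OF q]] by simp
  ultimately show ?thesis unfolding abs_mult[symmetric] by linarith
qed

text \<open>A point that is exceptional for the sawtooth average lies near a fraction \<open>p / s\<close>; it is recorded by
  \<open>(s, p, j)\<close>, where \<open>j\<close> is its offset from \<open>p / s\<close> in units of half the grid mesh. The point of the
  definition is that the set of labels does not depend on \<open>N\<close>.\<close>

definition near_rational :: "nat \<Rightarrow> (nat \<times> int \<times> int) set" where
  "near_rational K = {1..K} \<times> {-3 * int K..3 * int K} \<times> {- 4 * int (K * K) - 1..4 * int (K * K)}"

text \<open>By \<open>sawtooth_average\<close> each point has a small sum or lies near a fraction
  \<open>p / s\<close>. Points of the second kind have distinct labels in
  \<open>near_rational K\<close>, since two with equal labels would be less than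
  \<open>1 / (2 * N)\<close> apart. So their number is bounded independently of \<open>N\<close>,
  and each contributes at most \<open>T\<close>.\<close>

lemma sawtooth_separated:
  fixes K N T :: nat and S :: "real set"
  assumes K: "0 < K" and div: "\<forall>s\<in>{1..K}. s dvd T" and T: "K * K \<le> T"
    and N: "0 < N" "N \<le> 2 * K * T"
    and S: "finite S" "S \<subseteq> {-2..2}" and sep: "\<And>x y. \<lbrakk>x \<in> S; y \<in> S; x < y\<rbrakk> \<Longrightarrow> 1 / (2 * N) \<le> y - x"
  shows "(\<Sum>\<tau>\<in>S. \<bar>\<Sum>n=N..<N+T. frac (real n * \<tau>) - 1/2\<bar>) \<le> card S * (3 * T / K) + card (near_rational K) * T"
proof -
  have Tp: "0 < T" using T K by (metis gr0I mult_is_0 not_le)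
  let ?\<sigma> = "\<lambda>\<tau>. \<bar>\<Sum>n=N..<N+T. frac (real n * \<tau>) - 1/2\<bar>"
  have "\<exists>z :: nat \<times> int. 0 < fst z \<and> fst z \<le> K \<and> \<bar>\<tau> - snd z / fst z\<bar> < 1 \<and>
      (\<bar>\<tau> - snd z / fst z\<bar> < K / T \<or> ?\<sigma> \<tau> \<le> 3 * T / K)" for \<tau>
  proof -
    obtain s :: nat and p :: int where "0 < s" "s \<le> K" "\<bar>\<tau> - p / s\<bar> < 1"
      "\<bar>\<tau> - p / s\<bar> < K / T \<or> ?\<sigma> \<tau> \<le> (3 * T) / K"
      by (rule sawtooth_average[OF K div T, where N = N and \<tau> = \<tau>])
    then show ?thesis by (intro exI[of _ "(s, p)"]) simp
  qed
  then obtain z :: "real \<Rightarrow> nat \<times> int" where zz: "\<And>\<tau>. 0 < fst (z \<tau>) \<and> fst (z \<tau>) \<le> K \<and> \<bar>\<tau> - snd (z \<tau>) / fst (z \<tau>)\<bar> < 1 \<and>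
      (\<bar>\<tau> - snd (z \<tau>) / fst (z \<tau>)\<bar> < K / T \<or> ?\<sigma> \<tau> \<le> 3 * T / K)"
    by metis
  have z: "0 < fst (z \<tau>)" "fst (z \<tau>) \<le> K" "\<bar>\<tau> - snd (z \<tau>) / fst (z \<tau>)\<bar> < 1"
    "\<bar>\<tau> - snd (z \<tau>) / fst (z \<tau>)\<bar> < K / T \<or> ?\<sigma> \<tau> \<le> 3 * T / K" for \<tau>
    using zz[of \<tau>] by simp_all
  define r where "r \<tau> = \<tau> - snd (z \<tau>) / fst (z \<tau>)" for \<tau>
  define B where "B = {\<tau> \<in> S. \<bar>r \<tau>\<bar> < K / T}"
  define g where "g \<tau> = (fst (z \<tau>), snd (z \<tau>), \<lfloor>r \<tau> * (2 * N)\<rfloor>)" for \<tau>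
  have "card B \<le> card (near_rational K)"
  proof (rule card_inj_on_le[of g])
    show "finite (near_rational K)" unfolding near_rational_def by simp
    have close: "\<not> x < y" if xy: "x \<in> B" "y \<in> B" "g x = g y" for x y
    proof
      assume "x < y"
      then have "1 / (2 * N) \<le> y - x" using xy sep unfolding B_def by auto
      also have "\<dots> = r y - r x" using xy unfolding r_def g_def by simp
      finally have "1 \<le> (r y - r x) * (2 * N)" using N by (simp add: field_simps)
      then have "1 \<le> r y * (2 * N) - r x * (2 * N)" by (simp add: algebra_simps)
      moreover have "\<lfloor>r x * (2 * N)\<rfloor> = \<lfloor>r y * (2 * N)\<rfloor>" using xy unfolding g_def by simp
      ultimately show False by linarith
    qed
    show "inj_on g B" by (intro inj_onI) (metis close linorder_neqE)
    show "g ` B \<subseteq> near_rational K"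
    proof (intro image_subsetI)
      fix \<tau> assume \<tau>: "\<tau> \<in> B"
      define s p where "s = fst (z \<tau>)" and "p = snd (z \<tau>)"
      have s: "0 < s" "s \<le> K" unfolding s_def using z by auto
      have "\<tau> \<in> {-2..2}" using \<tau> S(2) unfolding B_def by blast
      then have "\<bar>\<tau>\<bar> \<le> 2" by auto
      moreover have "\<bar>\<tau> - p / s\<bar> < 1" using z(3) unfolding s_def p_def by simp
      ultimately have "\<bar>p / s\<bar> \<le> 3" by linarith
      then have "\<bar>real_of_int p\<bar> \<le> 3 * s" using s by (simp add: field_simps)
      also have "\<dots> \<le> 3 * K" using s by simp
      finally have p: "\<bar>p\<bar> \<le> 3 * int K" by linarith
      \<comment> \<open>Because \<open>N \<le> 2 * K * T\<close>, the radius \<open>K / T\<close>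
        amounts to a number of half meshes that depends on \<open>K\<close> alone.\<close>
      have "\<bar>r \<tau>\<bar> * (2 * N) \<le> K / T * real (2 * (2 * K * T))"
      proof (intro mult_mono)
        show "\<bar>r \<tau>\<bar> \<le> K / T" using \<tau> unfolding B_def by auto
        show "real (2 * N) \<le> real (2 * (2 * K * T))" using N(2) unfolding of_nat_le_iff by simp
      qed auto
      also have "\<dots> = 4 * real (K * K)" using Tp by simp
      finally have "\<bar>r \<tau> * (2 * N)\<bar> \<le> real_of_int (4 * int (K * K))" by (simp add: abs_mult)
      then have "-4 * int (K * K) - 1 \<le> \<lfloor>r \<tau> * (2 * N)\<rfloor>" "\<lfloor>r \<tau> * (2 * N)\<rfloor> \<le> 4 * int (K * K)" by linarith+
      then show "g \<tau> \<in> near_rational K"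
        using p s unfolding g_def near_rational_def s_def[symmetric] p_def[symmetric] by auto
    qed
  qed
  have fB: "finite B" "B \<subseteq> S" unfolding B_def using S by auto
  have "?\<sigma> \<tau> \<le> 3 * T / K + (if \<tau> \<in> B then T else 0)" if "\<tau> \<in> S" for \<tau>
  proof (cases "\<tau> \<in> B")
    case True
    have "?\<sigma> \<tau> \<le> (\<Sum>n=N..<N+T. 1)"
    proof (rule order_trans[OF sum_abs sum_mono])
      fix n show "\<bar>frac (real n * \<tau>) - 1/2\<bar> \<le> 1" using frac_ge_0[of "real n * \<tau>"] frac_lt_1[of "real n * \<tau>"] by linarith
    qed
    then show ?thesis using True by (simp add: add_increasing)
  next
    case False
    then show ?thesis using z(4)[of \<tau>] that unfolding B_def r_def by auto
  qed
  then have "(\<Sum>\<tau>\<in>S. ?\<sigma> \<tau>) \<le> (\<Sum>\<tau>\<in>S. 3 * T / K + (if \<tau> \<in> B then T else 0))" by (rule sum_mono)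
  also have "\<dots> = card S * (3 * T / K) + (\<Sum>\<tau>\<in>S \<inter> B. real T)"
    unfolding sum.distrib sum.inter_restrict[OF S(1)] by (simp add: if_distrib cong: if_cong)
  also have "S \<inter> B = B" using fB by blast
  also have "(\<Sum>\<tau>\<in>B. real T) \<le> card (near_rational K) * real T"
    using \<open>card B \<le> card (near_rational K)\<close> by (simp add: mult_right_mono)
  finally show ?thesis by simp
qed

text \<open>By \<open>grid_sum_thick\<close> the error is a signed sum of defects over the ends of
  components; exchanging it with the sum over \<open>n\<close> leaves one sawtooth sum per end. Ends
  of one kind are \<open>\<eta>\<close>-separated, which \<open>d \<le> 2 * N * \<eta>\<close> turns
  into the separation required by \<open>sawtooth_separated\<close>, and their number is at most the
  measure over \<open>\<eta>\<close>.\<close>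

lemma thick_grid_error:
  fixes K N T :: nat and a d \<eta> u v C :: real
  assumes K: "0 < K" and div: "\<forall>s\<in>{1..K}. s dvd T" and T: "K * K \<le> T"
    and N: "0 < N" "N \<le> 2 * K * T"
    and F: "finite F" "F \<subseteq> {a..a + d}" and d: "0 < d" and \<eta>: "0 < \<eta>" "\<eta> \<le> d" "d \<le> 2 * N * \<eta>"
    and C: "\<forall>t\<in>{a - d..a + d}. \<bar>u + v * t\<bar> \<le> C"
  shows "\<bar>\<Sum>n=N..<N+T. grid_sum a (d / n) (\<lambda>x. u + v * x) (thick F \<eta>) - (n / d) * (LINT x:thick F \<eta>|lborel. u + v * x)\<bar>
    \<le> T * (C * (6 / K * (measure lborel (thick F \<eta>) / \<eta>) + 2 * card (near_rational K))
        + \<bar>v\<bar> * d / (4 * N) * (measure lborel (thick F \<eta>) / \<eta>))"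
proof -
  define Q where "Q = measure lborel (thick F \<eta>) / \<eta>"
  have C0: "0 \<le> C" using bspec[OF C, of a] d by force
  define E where "E t = (\<Sum>n=N..<N+T. grid_defect a (d / real n) u v t)" for t
  \<comment> \<open>This is used with \<open>c = 0\<close> for the right ends and with
    \<open>c = \<eta>\<close> for the left ends.\<close>
  have ends: "\<bar>\<Sum>x\<in>S. E (x - c)\<bar> \<le> T * (C * (3 / K * Q + card (near_rational K)) + \<bar>v\<bar> * d / (8 * N) * Q)"
    if S: "S \<subseteq> F" and sep: "\<And>x y. \<lbrakk>x < y; x \<in> S; y \<in> S\<rbrakk> \<Longrightarrow> \<eta> < y - x"
      and card: "card S * \<eta> \<le> measure lborel (thick F \<eta>)" and c: "0 \<le> c" "c \<le> d" for S c
  proof -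
    define g where "g x = (x - c - a) / d" for x :: real
    have fS: "finite S" using S F(1) finite_subset by blast
    have inj: "inj_on g S" unfolding g_def inj_on_def using d by simp
    have cS: "card S \<le> Q" unfolding Q_def using card \<eta>(1) by (simp add: field_simps)
    have "(\<Sum>x\<in>S. \<bar>\<Sum>n=N..<N+T. frac (real n * g x) - 1/2\<bar>)
      = (\<Sum>\<tau>\<in>g ` S. \<bar>\<Sum>n=N..<N+T. frac (real n * \<tau>) - 1/2\<bar>)"
      using inj by (simp add: sum.reindex)
    also have "\<dots> \<le> card (g ` S) * (3 * T / K) + card (near_rational K) * T"
    proof (rule sawtooth_separated[OF K div T N])
      show "g ` S \<subseteq> {-2..2}"
      proof (intro image_subsetI)
        fix x assume "x \<in> S"
        then have "x \<in> {a..a + d}" using S F(2) by blast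
        then show "g x \<in> {-2..2}" using c d unfolding g_def by (simp add: pos_le_divide_eq pos_divide_le_eq)
      qed
      fix \<tau> \<tau>' assume "\<tau> \<in> g ` S" "\<tau>' \<in> g ` S" "\<tau> < \<tau>'"
      then obtain x y where xy: "x \<in> S" "y \<in> S" "\<tau> = g x" "\<tau>' = g y" by (elim imageE)
      have "g y \<le> g x" if "y \<le> x" unfolding g_def using that d by (intro divide_right_mono) auto
      then have "x < y" using \<open>\<tau> < \<tau>'\<close> unfolding xy(3,4) by linarith
      then have "\<eta> < y - x" using xy(1,2) by (rule sep)
      moreover have "\<tau>' - \<tau> = (y - x) / d" unfolding xy g_def by (simp add: diff_divide_distrib)
      moreover have "1 / (2 * N) \<le> \<eta> / d"
        using \<eta>(3) d N(1) by (simp add: pos_divide_le_eq pos_le_divide_eq mult.commute)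
      moreover have "\<eta> / d \<le> (y - x) / d" using calculation d by (intro divide_right_mono) auto
      ultimately show "1 / (2 * N) \<le> \<tau>' - \<tau>" by linarith
    qed (use fS in simp_all)
    also have "\<dots> \<le> Q * (3 * T / K) + card (near_rational K) * T"
      using cS inj by (intro add_right_mono mult_right_mono) (auto simp: card_image)
    finally have saw: "(\<Sum>x\<in>S. \<bar>\<Sum>n=N..<N+T. frac (real n * g x) - 1/2\<bar>) \<le> Q * (3 * T / K) + card (near_rational K) * T" .
    have "\<bar>\<Sum>x\<in>S. E (x - c)\<bar> \<le> (\<Sum>x\<in>S. C * \<bar>\<Sum>n=N..<N+T. frac (real n * g x) - 1/2\<bar> + T * (\<bar>v\<bar> * d / (8 * N)))"
    proof (rule order_trans[OF sum_abs sum_mono])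
      fix x assume x: "x \<in> S"
      then have "x \<in> {a..a + d}" using S F(2) by blast
      then have "\<bar>u + v * (x - c)\<bar> \<le> C" using c by (intro bspec[OF C]) auto
      then have "\<bar>u + v * (x - c)\<bar> * \<bar>\<Sum>n=N..<N+T. frac (real n * g x) - 1/2\<bar> \<le> C * \<bar>\<Sum>n=N..<N+T. frac (real n * g x) - 1/2\<bar>"
        by (rule mult_right_mono) simp
      then show "\<bar>E (x - c)\<bar> \<le> C * \<bar>\<Sum>n=N..<N+T. frac (real n * g x) - 1/2\<bar> + T * (\<bar>v\<bar> * d / (8 * N))"
        using grid_defect_sum[OF d N(1), of a u v "x - c" T] unfolding E_def g_def by linarith
    qed
    also have "\<dots> = C * (\<Sum>x\<in>S. \<bar>\<Sum>n=N..<N+T. frac (real n * g x) - 1/2\<bar>) + card S * (T * (\<bar>v\<bar> * d / (8 * N)))"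
      by (simp only: sum.distrib sum_distrib_left sum_constant)
    also have "\<dots> \<le> C * (Q * (3 * T / K) + card (near_rational K) * T) + Q * (T * (\<bar>v\<bar> * d / (8 * N)))"
      using saw cS C0 d by (intro add_mono mult_left_mono mult_right_mono) auto
    also have "\<dots> = T * (C * (3 / K * Q + card (near_rational K)) + \<bar>v\<bar> * d / (8 * N) * Q)"
      by (simp add: algebra_simps)
    finally show ?thesis .
  qed
  have "(\<Sum>n=N..<N+T. grid_sum a (d / n) (\<lambda>x. u + v * x) (thick F \<eta>) - (n / d) * (LINT x:thick F \<eta>|lborel. u + v * x))
    = (\<Sum>n=N..<N+T. (\<Sum>x\<in>right_ends F \<eta>. grid_defect a (d / n) u v (x - 0)) - (\<Sum>x\<in>left_ends F \<eta>. grid_defect a (d / n) u v (x - \<eta>)))"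
  proof (rule sum.cong[OF refl])
    fix n assume "n \<in> {N..<N+T}"
    then have "0 < d / n" using N d by auto
    from grid_sum_thick[OF F(1) \<eta>(1) this, of a u v]
    show "grid_sum a (d / n) (\<lambda>x. u + v * x) (thick F \<eta>) - (n / d) * (LINT x:thick F \<eta>|lborel. u + v * x)
      = (\<Sum>x\<in>right_ends F \<eta>. grid_defect a (d / n) u v (x - 0)) - (\<Sum>x\<in>left_ends F \<eta>. grid_defect a (d / n) u v (x - \<eta>))"
      by (simp add: mult.commute)
  qed
  also have "\<dots> = (\<Sum>x\<in>right_ends F \<eta>. E (x - 0)) - (\<Sum>x\<in>left_ends F \<eta>. E (x - \<eta>))"
    unfolding sum_subtractf E_def by (intro arg_cong2[where f = "(-)"] sum.swap)
  also have "\<bar>\<dots>\<bar> \<le> 2 * (T * (C * (3 / K * Q + card (near_rational K)) + \<bar>v\<bar> * d / (8 * N) * Q))"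
  proof -
    have "\<bar>\<Sum>x\<in>right_ends F \<eta>. E (x - 0)\<bar> \<le> T * (C * (3 / K * Q + card (near_rational K)) + \<bar>v\<bar> * d / (8 * N) * Q)"
      by (rule ends[OF ends_subset(1) ends_separated(1) card_ends(1)[OF F(1) \<eta>(1)]]) (use d in simp_all)
    moreover have "\<bar>\<Sum>x\<in>left_ends F \<eta>. E (x - \<eta>)\<bar> \<le> T * (C * (3 / K * Q + card (near_rational K)) + \<bar>v\<bar> * d / (8 * N) * Q)"
      by (rule ends[OF ends_subset(2) ends_separated(2) card_ends(2)[OF F(1) \<eta>(1)]]) (use \<eta> in simp_all)
    ultimately show ?thesis by linarith
  qed
  also have "\<dots> = T * (C * (6 / K * Q + 2 * card (near_rational K)) + \<bar>v\<bar> * d / (4 * N) * Q)"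
    by (simp add: algebra_simps)
  finally show ?thesis unfolding Q_def .
qed

section \<open>The mean as a limit of barycentres\<close>

lemma eds_cell_eq:
  assumes "0 < n"
  shows "eds_cell H n i = H \<inter> {Inf H + real i * ((Sup H - Inf H) / n)..<Inf H + real (Suc i) * ((Sup H - Inf H) / n)}"
  unfolding eds_cell_def using assms by simp

text \<open>Distinct cells are disjoint. Injectivity is needed since \<open>arith_mean\<close> sums
  over the set of chosen points, whereas the estimates sum over indices.\<close>

lemma eds_choice_inj:
  assumes "0 < n" "Inf H < Sup H" and \<xi>: "\<forall>i\<in>eds_index H n. \<xi> i \<in> eds_cell H n i"
  shows "inj_on \<xi> (eds_index H n)"
proof (rule inj_onI, rule ccontr)
  have *: False if ij: "i \<in> eds_index H n" "j \<in> eds_index H n" "\<xi> i = \<xi> j" "i < j" for i j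
  proof -
    let ?w = "(Sup H - Inf H) / n"
    have "0 < ?w" using assms by simp
    then have "real (Suc i) * ?w \<le> real j * ?w" using ij(4) by (intro mult_right_mono) auto
    then show False using bspec[OF \<xi> ij(1)] bspec[OF \<xi> ij(2)] ij(3) unfolding eds_cell_eq[OF assms(1)] by auto
  qed
  fix i j assume "i \<in> eds_index H n" "j \<in> eds_index H n" "\<xi> i = \<xi> j" "i \<noteq> j"
  then show False using *[of i j] *[of j i] by (cases "i < j") auto
qed

lemma eds_index_finite: "finite (eds_index H n)"
  unfolding eds_index_def by simp

text \<open>As the mesh lies between \<open>\<delta>'\<close> and \<open>\<delta>\<close>, the set
  \<open>I\<close> of occupied indices is contained in \<open>Z \<delta>\<close> and contains
  \<open>Z \<delta>'\<close> up to one index. Over \<open>I\<close> the grid points average to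
  \<open>k\<close> within \<open>2 * e\<close>: one \<open>e\<close> stems from the mean, the other
  from moving the chosen points to the left ends of their cells. Each index of
  \<open>Z \<delta>\<close> outside \<open>I\<close> costs at most \<open>C\<close>, and their
  number is controlled by the two grid counts.\<close>

lemma eds_grid_estimate:
  fixes H :: "real set" and \<xi> :: "nat \<Rightarrow> real"
  defines "a \<equiv> Inf H" and "b \<equiv> Sup H"
  assumes H: "bounded H" and n: "0 < n" and ab: "a < b"
    and \<xi>: "\<forall>i\<in>eds_index H n. \<xi> i \<in> eds_cell H n i"
    and mean: "\<bar>arith_mean (\<xi> ` eds_index H n) - k\<bar> \<le> e"
    and F: "finite F" "F \<subseteq> H" "\<xi> ` eds_index H n \<subseteq> F"
    and w: "\<delta>' \<le> (b - a) / n" "(b - a) / n \<le> \<delta>" "\<delta> \<le> e"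
    and C: "\<forall>t\<in>{a - \<delta>..b}. \<bar>t - k\<bar> \<le> C"
  shows "\<bar>grid_sum a ((b - a) / n) (\<lambda>x. x - k) (thick F \<delta>)\<bar>
    \<le> 2 * e * grid_sum a ((b - a) / n) (\<lambda>x. 1) (thick F \<delta>)
      + C * (grid_sum a ((b - a) / n) (\<lambda>x. 1) (thick F \<delta>) - grid_sum a ((b - a) / n) (\<lambda>x. 1) (thick F \<delta>') + 1)"
proof -
  define w where "w = (b - a) / n"
  have w0: "0 < w" unfolding w_def using ab n by simp
  have e0: "0 < e" using w w0 unfolding w_def by linarith
  define I where "I = int ` eds_index H n"
  define Z where "Z \<eta> = {i. a + real_of_int i * w \<in> thick F \<eta>}" for \<eta>
  have gs: "grid_sum a w f (thick F \<eta>) = (\<Sum>i\<in>Z \<eta>. f (a + real_of_int i * w))" for f \<eta>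
    unfolding grid_sum_def Z_def ..
  have finZ: "finite (Z \<eta>)" for \<eta> unfolding Z_def by (rule finite_grid[OF thick_bounded[OF F(1)] w0])
  have finI: "finite I" unfolding I_def by (simp add: eds_index_finite)
  have cardI: "card I = card (eds_index H n)" unfolding I_def by (intro card_image inj_onI) simp
  have Hab: "a \<le> x" "x \<le> b" if "x \<in> H" for x
    using that H unfolding a_def b_def by (auto intro: cInf_lower cSup_upper bounded_imp_bdd_below bounded_imp_bdd_above)
  have cell: "eds_cell H n i = H \<inter> {a + real i * w..<a + real (Suc i) * w}" for i
    unfolding w_def a_def b_def by (rule eds_cell_eq[OF n])
  have IZ: "I \<subseteq> Z \<delta>"
  proof
    fix j assume "j \<in> I"
    then obtain i where i: "i \<in> eds_index H n" "j = int i" unfolding I_def by auto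
    have "\<xi> i \<in> F" using F(3) i by auto
    moreover have "\<xi> i \<in> {a + real i * w..<a + real i * w + \<delta>}"
      using bspec[OF \<xi> i(1)] w(2) unfolding cell w_def[symmetric] by (auto simp: algebra_simps)
    ultimately show "j \<in> Z \<delta>" unfolding Z_def thick_iff i(2) by auto
  qed
  \<comment> \<open>The index \<open>n\<close> belongs to the grid point \<open>Sup H\<close>, which
    can lie in the thickening but starts no cell. It causes the \<open>+ 1\<close> in the
    estimate.\<close>
  have ZI: "Z \<delta>' \<subseteq> insert (int n) I"
  proof
    fix i assume "i \<in> Z \<delta>'"
    then obtain h where h: "h \<in> F" "a + real_of_int i * w \<le> h" "h < a + real_of_int i * w + \<delta>'"
      unfolding Z_def thick_iff by auto
    have hH: "h \<in> H" using h F(2) by auto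
    have hu: "h < a + (real_of_int i + 1) * w" using h(3) w(1) unfolding w_def[symmetric] by (simp add: algebra_simps)
    have "0 < (real_of_int i + 1) * w" using hu Hab[OF hH] by linarith
    then have i0: "0 \<le> i" using w0 by (simp add: zero_less_mult_iff)
    have "real_of_int i * w \<le> real n * w" using h(2) Hab[OF hH] n unfolding w_def by simp
    then have "i \<le> int n" using w0 by simp
    moreover have "i \<in> I" if "i < int n"
    proof -
      obtain m where m: "i = int m" using i0 nonneg_int_cases by blast
      have "h \<in> eds_cell H n m" unfolding cell using hH h(2) hu unfolding m by (simp add: algebra_simps)
      then have "m \<in> eds_index H n" unfolding eds_index_def using that m by auto
      then show ?thesis unfolding I_def m by (rule imageI)
    qed
    ultimately show "i \<in> insert (int n) I" by fastforce
  qed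
  have card': "card (Z \<delta>') \<le> card I + 1"
    using card_mono[OF _ ZI] finI by (simp add: card_insert_if split: if_splits)
  have sI: "\<bar>\<Sum>i\<in>I. a + real_of_int i * w - k\<bar> \<le> 2 * e * card I"
  proof (cases "eds_index H n = {}")
    case True
    then show ?thesis unfolding I_def by simp
  next
    case False
    define m where "m = card (eds_index H n)"
    have m: "0 < m" unfolding m_def using False eds_index_finite by (simp add: card_gt_0_iff)
    note inj = eds_choice_inj[OF n ab[unfolded a_def b_def] \<xi>]
    have "arith_mean (\<xi> ` eds_index H n) = (\<Sum>i\<in>eds_index H n. \<xi> i) / m"
      unfolding arith_mean_def m_def using inj by (simp add: sum.reindex card_image)
    then have "\<bar>((\<Sum>i\<in>eds_index H n. \<xi> i) - m * k) / m\<bar> \<le> e" using mean m by (simp add: diff_divide_distrib)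
    then have 1: "\<bar>(\<Sum>i\<in>eds_index H n. \<xi> i) - m * k\<bar> \<le> e * m" using m by (simp add: field_simps)
    have "\<bar>\<Sum>i\<in>eds_index H n. (a + real i * w) - \<xi> i\<bar> \<le> (\<Sum>i\<in>eds_index H n. w)"
    proof (rule order_trans[OF sum_abs sum_mono])
      fix i assume "i \<in> eds_index H n"
      then show "\<bar>(a + real i * w) - \<xi> i\<bar> \<le> w" using bspec[OF \<xi>, of i] unfolding cell by (auto simp: algebra_simps)
    qed
    also have "\<dots> = m * w" unfolding m_def by simp
    also have "\<dots> \<le> m * e" using w by (intro mult_left_mono) (auto simp: w_def)
    finally have 2: "\<bar>(\<Sum>i\<in>eds_index H n. (a + real i * w)) - (\<Sum>i\<in>eds_index H n. \<xi> i)\<bar> \<le> m * e"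
      by (simp add: sum_subtractf)
    have "(\<Sum>i\<in>I. a + real_of_int i * w - k) = (\<Sum>i\<in>eds_index H n. (a + real i * w) - k)"
      unfolding I_def by (subst sum.reindex) (auto intro: inj_onI)
    also have "\<dots> = (\<Sum>i\<in>eds_index H n. (a + real i * w)) - m * k"
      unfolding sum_subtractf m_def by simp
    finally show ?thesis using 1 2 unfolding cardI m_def[symmetric] by (simp add: algebra_simps; linarith)
  qed
  have sZ: "\<bar>\<Sum>i\<in>Z \<delta> - I. a + real_of_int i * w - k\<bar> \<le> C * card (Z \<delta> - I)"
  proof -
    have "\<bar>a + real_of_int i * w - k\<bar> \<le> C" if "i \<in> Z \<delta>" for i
    proof (rule bspec[OF C])
      have "F \<subseteq> {a..b}" using F(2) Hab by auto
      from thick_subset[OF this, of \<delta>] show "a + real_of_int i * w \<in> {a - \<delta>..b}" using that unfolding Z_def by auto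
    qed
    then have "(\<Sum>i\<in>Z \<delta> - I. \<bar>a + real_of_int i * w - k\<bar>) \<le> card (Z \<delta> - I) * C"
      by (intro sum_bounded_above) auto
    then show ?thesis unfolding mult.commute[of C] by (rule order_trans[OF sum_abs])
  qed
  have C0: "0 \<le> C" using bspec[OF C, of b] ab w w0 unfolding w_def by force
  have cI: "card I \<le> card (Z \<delta>)" and cZI: "real (card (Z \<delta> - I)) = real (card (Z \<delta>)) - real (card I)"
    using card_mono[OF finZ IZ] card_Diff_subset[OF finI IZ] by (simp_all add: of_nat_diff)
  have "(\<Sum>i\<in>Z \<delta>. a + real_of_int i * w - k) = (\<Sum>i\<in>Z \<delta> - I. a + real_of_int i * w - k) + (\<Sum>i\<in>I. a + real_of_int i * w - k)"
    by (rule sum.subset_diff[OF IZ finZ])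
  then have "\<bar>\<Sum>i\<in>Z \<delta>. a + real_of_int i * w - k\<bar> \<le> C * (real (card (Z \<delta>)) - card I) + 2 * e * card I"
    using sI sZ unfolding cZI by linarith
  also have "\<dots> \<le> C * (real (card (Z \<delta>)) - card (Z \<delta>') + 1) + 2 * e * card (Z \<delta>)"
    using card' cI C0 e0 by (intro add_mono mult_left_mono) auto
  finally show ?thesis unfolding w_def[symmetric] gs by simp
qed

lemma thick_mono_radius: "\<delta>' \<le> \<delta> \<Longrightarrow> thick F \<delta>' \<subseteq> thick F \<delta>"
  unfolding thick_def by (intro UN_mono) auto

text \<open>\<open>eds_grid_estimate\<close> is summed over the meshes \<open>d / n\<close> for
  \<open>N \<le> n < N + T\<close>. By \<open>thick_grid_error\<close> the grid sums
  \<open>P\<close>, \<open>A\<close>, \<open>A'\<close> are then close to \<open>\<nu>\<close> times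
  the integrals \<open>X\<close>, \<open>U\<close>, \<open>V\<close>. The excess of \<open>A\<close>
  over \<open>A'\<close> is small because \<open>U\<close> and \<open>V\<close> differ by at most
  \<open>2 / K * U\<close>, and what remains is a bound for \<open>X\<close> in terms of
  \<open>U\<close>.\<close>

lemma thick_mean_bound:
  fixes H :: "real set" and k C e \<delta> :: real and K :: nat
  defines "a \<equiv> Inf H" and "b \<equiv> Sup H"
  defines "E \<equiv> 15 * C / K"
  assumes H: "bounded H" and ab: "a < b"
    and C: "1 \<le> C" "\<And>t. t \<in> {a - (b - a)..b} \<Longrightarrow> \<bar>t - k\<bar> \<le> C"
    and K: "4 \<le> K" and e: "0 < e"
    and \<delta>: "0 < \<delta>" "\<delta> \<le> (b - a) / K" "\<delta> \<le> 1 / K" "\<delta> \<le> e" "real (2 * K ^ 3 * fact K) \<le> (b - a) / \<delta>"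
    and mean: "\<And>n \<xi>. \<lbrakk>(b - a) / \<delta> \<le> real n; \<forall>i\<in>eds_index H n. \<xi> i \<in> eds_cell H n i\<rbrakk> \<Longrightarrow> \<bar>arith_mean (\<xi> ` eds_index H n) - k\<bar> \<le> e"
    and S: "finite S" "S \<subseteq> H" "K * card (near_rational K) + K \<le> card S" "\<And>x y. \<lbrakk>x \<in> S; y \<in> S; x < y\<rbrakk> \<Longrightarrow> \<delta> < y - x"
  shows "\<exists>F0. finite F0 \<and> F0 \<subseteq> H \<and> (\<forall>F. finite F \<and> F0 \<subseteq> F \<and> F \<subseteq> H \<longrightarrow>
    \<bar>LINT x:thick F \<delta>|lborel. - k + 1 * x\<bar> \<le> (2 * e * (2 + E) + C * (5 / K + 2 * E) + E) * measure lborel (thick F \<delta>))"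
proof -
  define d where "d = b - a"
  have d: "0 < d" unfolding d_def using ab by simp
  have K0: "0 < K" using K by simp
  \<comment> \<open>From this \<open>N\<close> on, every mesh \<open>d / n\<close> is at most
    \<open>\<delta>\<close>.\<close>
  define N where "N = nat \<lceil>d / \<delta>\<rceil>"
  \<comment> \<open>\<open>T\<close> is about \<open>N / K\<close>, so the meshes vary little over
    the range; the factor \<open>fact K\<close> makes \<open>T\<close> divisible by every
    \<open>s \<le> K\<close>.\<close>
  define T where "T = fact K * (N div (K * fact K))"
  have N1: "d / \<delta> \<le> N" "N < d / \<delta> + 1" "0 < d / \<delta>" unfolding N_def using d \<delta>(1) by (auto, linarith+)
  have N0: "0 < N" using N1 by (metis of_nat_0_less_iff order_less_le_trans)
  have Nbig: "2 * K ^ 3 * fact K \<le> N" using \<delta>(5) N1(1) unfolding d_def[symmetric] by (metis of_nat_le_iff order_trans)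
  have div: "\<forall>s\<in>{1..K}. s dvd T" unfolding T_def by (auto intro!: dvd_mult2 dvd_fact)
  have KT: "K * T \<le> N"
    unfolding T_def by (metis div_times_less_eq_dividend mult.assoc mult.commute)
  have NT: "N \<le> 2 * K * T"
  proof -
    let ?m = "K * fact K" and ?q = "N div (K * fact K)"
    have m0: "0 < ?m" using K0 by simp
    have "K * fact K \<le> K ^ 3 * fact K" using K0 by (intro mult_right_mono) (auto simp: self_le_power)
    then have "?m \<le> N" using Nbig by linarith
    then have q: "1 \<le> ?q" using m0 by (simp add: div_greater_zero_iff Suc_leI)
    have "N < ?m * (?q + 1)" using m0 by (simp add: dividend_less_times_div add.commute)
    also have "\<dots> \<le> ?m * (2 * ?q)" using q by (intro mult_left_mono) auto
    also have "\<dots> = 2 * K * T" unfolding T_def by simp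
    finally show ?thesis by simp
  qed
  have TK: "K * K \<le> T"
  proof -
    have "2 * K ^ 3 * 1 \<le> 2 * K ^ 3 * fact K" by (intro mult_left_mono) (auto simp: fact_ge_1)
    then have "2 * K ^ 3 \<le> 2 * K * T" using Nbig NT by linarith
    then have "2 * K * (K * K) \<le> 2 * K * T" by (simp only: power3_eq_cube mult.assoc)
    then show ?thesis using K0 by simp
  qed
  have T0: "0 < T" using TK K0 by (metis gr0I mult_is_0 not_le)
  \<comment> \<open>A lower bound for all meshes of the range: with \<open>h = 1 / K\<close>,
    \<open>n\<close> is at most \<open>d / \<delta> * (1 + h)^2\<close>, and
    \<open>(1 - 2 * h) * (1 + h)^2 \<le> 1\<close>.\<close>
  define \<delta>' where "\<delta>' = (1 - 2 / K) * \<delta>"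
  have Kh: "2 / real K \<le> 1 / 2" using K by (simp add: field_simps)
  have \<delta>': "0 < \<delta>'" "\<delta>' \<le> \<delta>" "\<delta> \<le> 2 * \<delta>'"
  proof -
    have "1/2 * \<delta> \<le> (1 - 2 / K) * \<delta>" using Kh \<delta>(1) by (intro mult_right_mono) auto
    moreover have "(1 - 2 / K) * \<delta> \<le> 1 * \<delta>" using \<delta>(1) by (intro mult_right_mono) auto
    ultimately show "0 < \<delta>'" "\<delta>' \<le> \<delta>" "\<delta> \<le> 2 * \<delta>'" unfolding \<delta>'_def using \<delta>(1) by auto
  qed
  have nlow: "1 / \<delta> \<le> n / d" if "n \<in> {N..<N+T}" for n
  proof -
    have "d / \<delta> \<le> n" using N1(1) that by auto
    then show ?thesis using d by (simp add: pos_le_divide_eq)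
  qed
  have nup: "\<delta>' * n \<le> d" if "n \<in> {N..<N+T}" for n
  proof -
    define h where "h = 1 / real K"
    have h: "0 < h" "h \<le> 1/4" unfolding h_def using K by (auto simp: field_simps)
    have "T \<le> N * h" unfolding h_def using KT K0 by (simp add: pos_le_divide_eq mult.commute flip: of_nat_mult)
    then have "real n \<le> N * (1 + h)" using that by (simp add: algebra_simps)
    also have "1 \<le> d / \<delta> * h" using \<delta>(1,2) K0 unfolding h_def d_def by (simp add: pos_le_divide_eq)
    then have "real N \<le> d / \<delta> * (1 + h)" using N1(2) by (simp add: distrib_left)
    then have "N * (1 + h) \<le> d / \<delta> * (1 + h) * (1 + h)" using h by (intro mult_right_mono) auto
    finally have "\<delta>' * n \<le> \<delta>' * (d / \<delta> * (1 + h) * (1 + h))" using \<delta>'(1) by (intro mult_left_mono) simp_all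
    also have "\<dots> = d * ((1 - 2 * h) * (1 + h) * (1 + h))" unfolding \<delta>'_def h_def using \<delta>(1) by simp
    also have "(1 - 2 * h) * (1 + h) * (1 + h) = 1 - 3 * h\<^sup>2 - 2 * h * h\<^sup>2" by (simp add: algebra_simps power2_eq_square)
    also have "d * \<dots> \<le> d * 1"
    proof (intro mult_left_mono)
      have "0 \<le> 2 * h * h\<^sup>2" using h by simp
      then show "1 - 3 * h\<^sup>2 - 2 * h * h\<^sup>2 \<le> 1" using zero_le_power2[of h] by linarith
    qed (use d in simp)
    finally show ?thesis by simp
  qed
  have n0: "0 < n" if "n \<in> {N..<N+T}" for n using that N0 by auto
  define \<nu> where "\<nu> = (\<Sum>n=N..<N+T. real n / d)"
  have \<nu>: "T / \<delta> \<le> \<nu>" "\<nu> \<le> 2 * T / \<delta>"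
  proof -
    have "(\<Sum>n=N..<N+T. 1 / \<delta>) \<le> \<nu>" unfolding \<nu>_def by (intro sum_mono nlow)
    then show "T / \<delta> \<le> \<nu>" by simp
    have "n / d \<le> 2 / \<delta>" if "n \<in> {N..<N+T}" for n
    proof -
      have "\<delta> * n \<le> 2 * \<delta>' * n" using \<delta>'(3) by (intro mult_right_mono) auto
      then have "\<delta> * n \<le> 2 * d" using nup[OF that] by simp
      then show ?thesis using d \<delta>(1) by (simp add: pos_le_divide_eq pos_divide_le_eq mult.commute)
    qed
    then have "\<nu> \<le> (\<Sum>n=N..<N+T. 2 / \<delta>)" unfolding \<nu>_def by (rule sum_mono)
    then show "\<nu> \<le> 2 * T / \<delta>" by (simp add: mult.commute)
  qed
  define \<xi> where "\<xi> n i = (SOME x. x \<in> eds_cell H n i)" for n i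
  have \<xi>: "\<forall>i\<in>eds_index H n. \<xi> n i \<in> eds_cell H n i" for n
    unfolding \<xi>_def eds_index_def by (auto simp: some_in_eq)
  \<comment> \<open>Any \<open>F\<close> between \<open>F0\<close> and \<open>H\<close> meets
    exactly the cells that \<open>H\<close> meets, for every \<open>n\<close> of the range; through
    \<open>S\<close> its thickening has large measure in units of \<open>\<delta>\<close>.\<close>
  define F0 where "F0 = S \<union> (\<Union>n\<in>{N..<N+T}. \<xi> n ` eds_index H n)"
  have "finite F0" unfolding F0_def using S(1) eds_index_finite by auto
  moreover have "F0 \<subseteq> H" unfolding F0_def using S(2) \<xi> unfolding eds_cell_def by blast
  moreover have "\<bar>LINT x:thick F \<delta>|lborel. - k + 1 * x\<bar> \<le> (2 * e * (2 + E) + C * (5 / K + 2 * E) + E) * measure lborel (thick F \<delta>)"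
    if F: "finite F" "F0 \<subseteq> F" "F \<subseteq> H" for F
  proof -
    define U where "U = measure lborel (thick F \<delta>)"
    define V where "V = measure lborel (thick F \<delta>')"
    define X where "X = (LINT x:thick F \<delta>|lborel. - k + 1 * x)"
    define Q where "Q = U / \<delta>"
    define B where "B = real (card (near_rational K))"
    define gs where "gs n \<eta> f = grid_sum a (d / real n) f (thick F \<eta>)" for n \<eta> f
    define P where "P = (\<Sum>n=N..<N+T. gs n \<delta> (\<lambda>x. x - k))"
    define A where "A = (\<Sum>n=N..<N+T. gs n \<delta> (\<lambda>x. 1))"
    define A' where "A' = (\<Sum>n=N..<N+T. gs n \<delta>' (\<lambda>x. 1))"
    have U: "U = Q * \<delta>" unfolding Q_def using \<delta>(1) by simp
    have UV: "(1 - 2 / K) * U \<le> V"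
      using measure_thick_scale[OF F(1) \<delta>'(1,2)] \<delta>(1) unfolding U_def V_def \<delta>'_def by simp
    have VU: "V \<le> U" unfolding U_def V_def
      using measure_mono_bounded[OF thick_mono_radius[OF \<delta>'(2)]] F(1) thick_bounded by auto
    have "card S * \<delta> \<le> U" unfolding U_def
      by (rule measure_thick_ge[OF F(1) \<delta>(1) _ S(4)]) (use F(2) F0_def in auto)
    then have "card S \<le> Q" unfolding Q_def using \<delta>(1) by (simp add: pos_le_divide_eq)
    then have KB: "K * B + K \<le> Q" using S(3) unfolding B_def
      by (metis of_nat_add of_nat_le_iff of_nat_mult order_trans)
    have B0: "0 \<le> B" unfolding B_def by simp
    \<comment> \<open>The size of \<open>S\<close> was chosen for this: both the number of labels
      and the additive constant 1 become negligible against \<open>Q\<close>.\<close>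
    have KQ: "B \<le> Q / K" "1 \<le> Q / K"
    proof -
      have "0 \<le> real K * B" using B0 by simp
      then show "B \<le> Q / K" "1 \<le> Q / K" using KB K0 by (auto simp: pos_le_divide_eq mult.commute)
    qed
    have Q0: "0 \<le> Q" using KB B0 mult_nonneg_nonneg[OF of_nat_0_le_iff B0, of K] by linarith
    have E0: "0 \<le> E" unfolding E_def using C(1) by simp
    have VQ: "V / \<delta>' \<le> 2 * Q" "0 \<le> V / \<delta>'"
    proof -
      have "V * \<delta> \<le> U * (2 * \<delta>')" using VU \<delta>'(3) \<delta>(1) unfolding U_def V_def by (intro mult_mono) auto
      then show "V / \<delta>' \<le> 2 * Q" unfolding Q_def using \<delta>(1) \<delta>'(1) by (simp add: pos_le_divide_eq pos_divide_le_eq mult_ac)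
      show "0 \<le> V / \<delta>'" unfolding V_def using \<delta>'(1) by simp
    qed
    have dN: "d / (4 * N) \<le> 1 / (4 * K)"
    proof -
      have "d / N \<le> \<delta>" using N1(1) N0 \<delta>(1) by (simp add: pos_le_divide_eq pos_divide_le_eq mult.commute)
      then have "d / N \<le> 1 / K" using \<delta>(3) by linarith
      then show ?thesis by simp
    qed
    \<comment> \<open>The constant 15 in \<open>E\<close> is 12 + 2 + 1, from the regular endpoints,
      the exceptional ones and the slope term. Allowing \<open>q\<close> up to \<open>2 * Q\<close>
      covers the smaller radius \<open>\<delta>'\<close> as well.\<close>
    have err: "T * (C * (6 / K * q + 2 * B) + v * d / (4 * N) * q) \<le> T * Q * E" if "0 \<le> q" "q \<le> 2 * Q" "0 \<le> v" "v \<le> 1" for q v :: real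
    proof -
      have "C * (6 / K * q + 2 * B) \<le> C * (6 / K * (2 * Q) + 2 * (Q / K))"
        using that(2) KQ(1) C(1) by (intro mult_left_mono add_mono) auto
      moreover have "v * (d / (4 * N)) * q \<le> 1 * (1 / (4 * K)) * (2 * Q)"
        using that dN d Q0 by (intro mult_mono) auto
      moreover have "1 * (1 / (4 * K)) * (2 * Q) \<le> 1 * (Q / K)" using Q0 K0 by (simp add: divide_simps)
      moreover have "1 * (Q / K) \<le> C * (Q / K)" using C(1) Q0 by (intro mult_right_mono) auto
      moreover have "C * (6 / K * (2 * Q) + 2 * (Q / K)) + C * (Q / K) = Q * E" unfolding E_def by (simp add: field_simps)
      ultimately have "C * (6 / K * q + 2 * B) + v * d / (4 * N) * q \<le> Q * E" by simp
      then have "real T * (C * (6 / K * q + 2 * B) + v * d / (4 * N) * q) \<le> real T * (Q * E)" by (intro mult_left_mono) auto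
      then show ?thesis by simp
    qed
    have Fab: "F \<subseteq> {a..a + d}"
      using F(3) bounded_imp_bdd_below[OF H] bounded_imp_bdd_above[OF H] unfolding a_def b_def d_def
      by (auto intro!: cInf_lower cSup_upper)
    have \<delta>d: "\<delta> \<le> d" 
    proof -
      have "d / K \<le> d / 1" using K0 d by (intro divide_left_mono) auto
      then show ?thesis using \<delta>(2) unfolding d_def[symmetric] by simp
    qed
    have dN\<delta>: "d \<le> N * \<delta>" using N1(1) \<delta>(1) by (simp add: pos_divide_le_eq)
    have dN\<delta>': "d \<le> 2 * N * \<delta>'"
    proof -
      have "N * \<delta> \<le> N * (2 * \<delta>')" using \<delta>'(3) by (intro mult_left_mono) auto
      then show ?thesis using dN\<delta> by simp
    qed
    have dN2: "d \<le> 2 * N * \<delta>"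
      by (rule order_trans[OF dN\<delta>], rule mult_right_mono) (use \<delta>(1) in simp_all)
    note TGE = thick_grid_error[OF K0 div TK N0 NT F(1) Fab d]
    have CC: "\<forall>t\<in>{a - d..a + d}. \<bar>- k + 1 * t\<bar> \<le> C"
      using C(2) unfolding d_def by auto
    have eP: "\<bar>P - \<nu> * X\<bar> \<le> T * Q * E"
    proof -
      have "\<bar>\<Sum>n=N..<N+T. gs n \<delta> (\<lambda>x. - k + 1 * x) - (n / d) * X\<bar> \<le> T * (C * (6 / K * Q + 2 * B) + \<bar>1\<bar> * d / (4 * N) * Q)"
        using TGE[OF \<delta>(1) \<delta>d dN2 CC] unfolding gs_def X_def Q_def U_def B_def by simp
      also have "\<dots> \<le> T * Q * E" using err[of Q 1] Q0 by simp
      finally show ?thesis unfolding P_def \<nu>_def sum_distrib_right sum_subtractf by simp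
    qed
    have eA: "\<bar>A - \<nu> * U\<bar> \<le> T * Q * E"
    proof -
      have "\<bar>\<Sum>n=N..<N+T. gs n \<delta> (\<lambda>x. 1 + 0 * x) - (n / d) * (LINT x:thick F \<delta>|lborel. 1 + 0 * x)\<bar> \<le> T * (C * (6 / K * Q + 2 * B) + \<bar>0\<bar> * d / (4 * N) * Q)"
        using TGE[OF \<delta>(1) \<delta>d dN2, of 1 0 C] C(1) unfolding gs_def Q_def U_def B_def by simp
      also have "\<dots> \<le> T * Q * E" using err[of Q 0] Q0 by simp
      finally show ?thesis unfolding A_def \<nu>_def sum_distrib_right sum_subtractf U_def by (simp add: LINT_one)
    qed
    have eA': "\<bar>A' - \<nu> * V\<bar> \<le> T * Q * E"
    proof -
      have "\<bar>\<Sum>n=N..<N+T. gs n \<delta>' (\<lambda>x. 1 + 0 * x) - (n / d) * (LINT x:thick F \<delta>'|lborel. 1 + 0 * x)\<bar> \<le> T * (C * (6 / K * (V / \<delta>') + 2 * B) + \<bar>0\<bar> * d / (4 * N) * (V / \<delta>'))"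
        using TGE[OF \<delta>'(1) order_trans[OF \<delta>'(2) \<delta>d] dN\<delta>', of 1 0 C] C(1) unfolding gs_def V_def B_def by simp
      also have "\<dots> \<le> T * Q * E" using err[of "V / \<delta>'" 0] VQ by simp
      finally show ?thesis unfolding A'_def \<nu>_def sum_distrib_right sum_subtractf V_def by (simp add: LINT_one)
    qed
    have P: "\<bar>P\<bar> \<le> 2 * e * A + C * (A - A' + T)"
    proof -
      have "\<bar>P\<bar> \<le> (\<Sum>n=N..<N+T. 2 * e * gs n \<delta> (\<lambda>x. 1) + C * (gs n \<delta> (\<lambda>x. 1) - gs n \<delta>' (\<lambda>x. 1) + 1))"
        unfolding P_def
      proof (rule order_trans[OF sum_abs sum_mono])
        fix n assume n: "n \<in> {N..<N+T}"
        show "\<bar>gs n \<delta> (\<lambda>x. x - k)\<bar> \<le> 2 * e * gs n \<delta> (\<lambda>x. 1) + C * (gs n \<delta> (\<lambda>x. 1) - gs n \<delta>' (\<lambda>x. 1) + 1)"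
          unfolding gs_def a_def b_def d_def
        proof (rule eds_grid_estimate[OF H n0[OF n] ab[unfolded a_def b_def] \<xi>[of n] _ F(1,3)])
          have "d / \<delta> \<le> n" using nlow[OF n] d by (simp add: pos_le_divide_eq)
          then show "\<bar>arith_mean (\<xi> n ` eds_index H n) - k\<bar> \<le> e" using \<xi> by (intro mean) (auto simp: d_def)
          show "\<xi> n ` eds_index H n \<subseteq> F" using F(2) n unfolding F0_def by blast
          show "\<delta>' \<le> (Sup H - Inf H) / n" using nup[OF n] n0[OF n] unfolding d_def a_def b_def by (simp add: pos_le_divide_eq)
          show "(Sup H - Inf H) / n \<le> \<delta>" using nlow[OF n] n0[OF n] d \<delta>(1) unfolding d_def a_def b_def
            by (simp add: pos_le_divide_eq pos_divide_le_eq mult.commute)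
          show "\<forall>t\<in>{Inf H - \<delta>..Sup H}. \<bar>t - k\<bar> \<le> C"
            using C(2) \<delta>d unfolding a_def b_def d_def by auto
        qed (rule \<delta>(4))
      qed
      also have "\<dots> = 2 * e * A + C * (A - A' + T)"
        unfolding A_def A'_def by (simp add: sum.distrib sum_subtractf sum_distrib_left algebra_simps)
      finally show ?thesis .
    qed
    have \<nu>0: "0 \<le> \<nu>" using \<nu>(1) \<delta>(1) by (meson divide_nonneg_pos of_nat_0_le_iff order_trans)
    have \<nu>U: "\<nu> * U \<le> 2 * (T * Q)"
    proof -
      have "\<nu> * U \<le> 2 * T / \<delta> * U" using \<nu>(2) unfolding U_def by (intro mult_right_mono) auto
      then show ?thesis unfolding U using \<delta>(1) by simp
    qed
    have \<nu>V: "\<nu> * U - 4 / K * (T * Q) \<le> \<nu> * V"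
    proof -
      have "\<nu> * ((1 - 2 / K) * U) \<le> \<nu> * V" using UV \<nu>0 by (intro mult_left_mono) auto
      moreover have "2 / K * (\<nu> * U) \<le> 2 / K * (2 * (T * Q))" using \<nu>U by (intro mult_left_mono) auto
      ultimately show ?thesis by (simp add: algebra_simps)
    qed
    have "real T * 1 \<le> real T * (Q / K)" using KQ(2) by (intro mult_left_mono) auto
    then have "real T \<le> T * Q / K" by simp
    then have AA: "A - A' + T \<le> 4 / K * (T * Q) + 2 * (T * Q * E) + T * Q / K"
    proof -
      have "A - A' + r \<le> z + 2 * y + x" if "\<bar>A - p\<bar> \<le> y" "\<bar>A' - q\<bar> \<le> y" "p - z \<le> q" "r \<le> x" for p q r x y z
        using that by linarith
      from this[OF eA eA' \<nu>V \<open>real T \<le> T * Q / K\<close>] show ?thesis .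
    qed
    have A2: "A \<le> 2 * (T * Q) + T * Q * E" using eA \<nu>U by linarith
    have "\<nu> * \<bar>X\<bar> = \<bar>\<nu> * X\<bar>" using \<nu>0 by (simp add: abs_mult)
    also have "\<dots> \<le> \<bar>P\<bar> + T * Q * E" using eP by linarith
    also have "\<dots> \<le> 2 * e * (2 * (T * Q) + T * Q * E) + C * (4 / K * (T * Q) + 2 * (T * Q * E) + T * Q / K) + T * Q * E"
    proof -
      have "2 * e * A \<le> 2 * e * (2 * (T * Q) + T * Q * E)" using A2 e by (intro mult_left_mono) auto
      moreover have "C * (A - A' + T) \<le> C * (4 / K * (T * Q) + 2 * (T * Q * E) + T * Q / K)"
        using AA C(1) by (intro mult_left_mono) auto
      ultimately show ?thesis using P by linarith
    qed
    also have "\<dots> = T * Q * (2 * e * (2 + E) + C * (5 / K + 2 * E) + E)"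
      by (simp add: algebra_simps add_divide_distrib)
    finally have "\<nu> * \<bar>X\<bar> \<le> T * Q * (2 * e * (2 + E) + C * (5 / K + 2 * E) + E)" .
    \<comment> \<open>Since \<open>T * Q\<close> equals \<open>T / \<delta> * U\<close>, the factor
      \<open>T / \<delta>\<close> cancels.\<close>
    moreover have "T / \<delta> * \<bar>X\<bar> \<le> \<nu> * \<bar>X\<bar>" using \<nu>(1) by (intro mult_right_mono) auto
    ultimately have "T / \<delta> * \<bar>X\<bar> \<le> T / \<delta> * ((2 * e * (2 + E) + C * (5 / K + 2 * E) + E) * U)"
      unfolding U using \<delta>(1) by (simp add: mult_ac)
    then show ?thesis unfolding X_def[symmetric] U_def[symmetric] using T0 \<delta>(1) by (simp add: mult_le_cancel_left_pos divide_le_cancel)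
  qed
  ultimately show ?thesis by blast
qed

lemma eventually_separated:
  assumes "finite (S :: real set)"
  shows "eventually (\<lambda>\<delta>. \<forall>x\<in>S. \<forall>y\<in>S. x < y \<longrightarrow> \<delta> < y - x) (at_right 0)"
proof (intro eventually_ball_finite assms ballI)
  fix x y :: real
  show "eventually (\<lambda>\<delta>. x < y \<longrightarrow> \<delta> < y - x) (at_right 0)"
  proof (cases "x < y")
    case True
    then have "eventually (\<lambda>\<delta>. \<delta> \<in> {0<..<y - x}) (at_right 0)" by (intro eventually_at_right_real) auto
    then show ?thesis by eventually_elim auto
  qed simp
qed

lemma has_eds_meanD:
  assumes "has_eds_mean H k"
  shows "bounded H" "Inf H < Sup H" "\<And>x. x \<in> H \<Longrightarrow> Inf H \<le> x" "\<And>x. x \<in> H \<Longrightarrow> x \<le> Sup H"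
proof -
  show H: "bounded H" using assms unfolding has_eds_mean_def by simp
  show lo: "\<And>x. x \<in> H \<Longrightarrow> Inf H \<le> x" using bounded_imp_bdd_below[OF H] by (auto intro: cInf_lower)
  show up: "\<And>x. x \<in> H \<Longrightarrow> x \<le> Sup H" using bounded_imp_bdd_above[OF H] by (auto intro: cSup_upper)
  obtain x y where "x \<in> H" "y \<in> H" "x < y"
    using assms unfolding has_eds_mean_def by (metis linorder_neqE)
  then show "Inf H < Sup H" using lo[of x] up[of y] by linarith
qed

lemma has_eds_mean_bound:
  assumes "has_eds_mean H k" "0 < e"
  obtains M :: nat where "\<And>n \<xi>. \<lbrakk>M < n; \<forall>i\<in>eds_index H n. \<xi> i \<in> eds_cell H n i\<rbrakk> \<Longrightarrow> \<bar>arith_mean (\<xi> ` eds_index H n) - k\<bar> < e"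
  using assms unfolding has_eds_mean_def by blast

text \<open>Finite subsets \<open>F\<close> stand in for \<open>H\<close> to keep the thickenings finite unions of intervals.\<close>

lemma thick_mean:
  fixes H :: "real set"
  assumes mean: "has_eds_mean H k" and inf: "infinite H" and \<epsilon>: "0 < \<epsilon>"
  shows "eventually (\<lambda>\<delta>. \<exists>F0. finite F0 \<and> F0 \<subseteq> H \<and> (\<forall>F. finite F \<and> F0 \<subseteq> F \<and> F \<subseteq> H \<longrightarrow>
    \<bar>LINT x:thick F \<delta>|lborel. - k + 1 * x\<bar> \<le> \<epsilon> * measure lborel (thick F \<delta>))) (at_right 0)"
proof -
  define a b d where "a = Inf H" and "b = Sup H" and "d = b - a"
  note D = has_eds_meanD[OF mean]
  have ab: "a < b" and d: "0 < d" using D(2) unfolding a_def b_def d_def by auto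
  define C where "C = \<bar>a - k\<bar> + \<bar>b - k\<bar> + d + 1"
  have C1: "1 \<le> C" unfolding C_def using d by simp
  have CC: "\<bar>t - k\<bar> \<le> C" if "t \<in> {a - (b - a)..b}" for t
    using that unfolding C_def d_def by auto
  \<comment> \<open>The square of \<open>C\<close> is there because the final constant contains
    \<open>C * E\<close>, which is of order \<open>C * C / K\<close>.\<close>
  obtain K where K: "4 + 200 * (C * C) / \<epsilon> \<le> real K" using real_arch_simple by blast
  define e where "e = min 1 (\<epsilon> / 100)"
  have e: "0 < e" "e \<le> 1" "e \<le> \<epsilon> / 100" unfolding e_def using \<epsilon> by auto
  have "0 \<le> 200 * (C * C) / \<epsilon>" using \<epsilon> by simp
  then have K4: "4 \<le> K" and K2: "200 * (C * C) / \<epsilon> \<le> K" using K by linarith+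
  have K0: "0 < K" using K4 by simp
  define x where "x = C / K"
  have x0: "0 \<le> x" unfolding x_def using C1 by simp
  have Cx: "C * x \<le> \<epsilon> / 200"
    unfolding x_def using K2 K0 \<epsilon> by (simp add: pos_divide_le_eq pos_le_divide_eq mult_ac)
  have xC: "x \<le> C * x" using mult_right_mono[OF C1 x0] by simp
  have const: "2 * e * (2 + 15 * C / K) + C * (5 / K + 2 * (15 * C / K)) + 15 * C / K \<le> \<epsilon>"
  proof -
    have "2 * e * (2 + 15 * C / K) + C * (5 / K + 2 * (15 * C / K)) + 15 * C / K = 4 * e + 30 * (e * x) + 20 * x + 30 * (C * x)"
      unfolding x_def by (simp add: algebra_simps add_divide_distrib)
    moreover have "e * x \<le> 1 * x" using e x0 by (intro mult_right_mono) auto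
    ultimately show ?thesis using e(3) Cx xC x0 by linarith
  qed
  obtain M :: nat where M: "\<And>n \<xi>. \<lbrakk>M < n; \<forall>i\<in>eds_index H n. \<xi> i \<in> eds_cell H n i\<rbrakk> \<Longrightarrow> \<bar>arith_mean (\<xi> ` eds_index H n) - k\<bar> < e"
    using has_eds_mean_bound[OF mean e(1)] by blast
  obtain S where S: "S \<subseteq> H" "finite S" "card S = K * card (near_rational K) + K"
    using infinite_arbitrarily_large[OF inf] by blast
  define R where "R = real (2 * K ^ 3 * fact K)"
  have R: "0 < R" unfolding R_def using K0 by simp
  \<comment> \<open>The last two entries force \<open>d / \<delta>\<close> above \<open>R\<close>
    and above \<open>M\<close>; the latter puts every \<open>n \<ge> d / \<delta>\<close> into the
    range where the sample means are \<open>e\<close>-close to \<open>k\<close>.\<close>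
  define \<delta>0 where "\<delta>0 = Min {d / K, 1 / K, e, d / R, d / (real M + 1)}"
  have "0 < \<delta>0" unfolding \<delta>0_def using d K0 e R by simp
  then have "eventually (\<lambda>\<delta>. \<delta> \<in> {0<..<\<delta>0}) (at_right 0)" by (rule eventually_at_right_real)
  then show ?thesis using eventually_separated[OF S(2)]
  proof eventually_elim
    case (elim \<delta>)
    then have \<delta>: "0 < \<delta>" "\<delta> \<le> d / K" "\<delta> \<le> 1 / K" "\<delta> \<le> e" "\<delta> < d / R" "\<delta> < d / (real M + 1)"
      unfolding \<delta>0_def by auto
    have R\<delta>: "R \<le> d / \<delta>" using \<delta>(1,5) R by (simp add: pos_le_divide_eq pos_less_divide_eq mult.commute)
    have M\<delta>: "real M < d / \<delta>"
    proof -
      have "\<delta> * (real M + 1) < d" using \<delta>(6) by (simp add: pos_less_divide_eq)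
      then have "\<delta> * real M < d" using \<delta>(1) by (simp add: distrib_left)
      then show ?thesis using \<delta>(1) by (simp add: pos_less_divide_eq mult.commute)
    qed
    have "\<exists>F0. finite F0 \<and> F0 \<subseteq> H \<and> (\<forall>F. finite F \<and> F0 \<subseteq> F \<and> F \<subseteq> H \<longrightarrow>
      \<bar>LINT x:thick F \<delta>|lborel. - k + 1 * x\<bar> \<le> (2 * e * (2 + 15 * C / K) + C * (5 / K + 2 * (15 * C / K)) + 15 * C / K) * measure lborel (thick F \<delta>))"
    proof (rule thick_mean_bound[OF D(1,2) C1 CC[unfolded a_def b_def] K4 e(1) \<delta>(1)])
      show "\<delta> \<le> (Sup H - Inf H) / K" "\<delta> \<le> 1 / K" "\<delta> \<le> e" using \<delta> unfolding d_def a_def b_def by auto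
      show "real (2 * K ^ 3 * fact K) \<le> (Sup H - Inf H) / \<delta>" using R\<delta> unfolding R_def d_def a_def b_def .
      show "\<bar>arith_mean (\<xi> ` eds_index H n) - k\<bar> \<le> e"
        if "(Sup H - Inf H) / \<delta> \<le> real n" "\<forall>i\<in>eds_index H n. \<xi> i \<in> eds_cell H n i" for n \<xi>
      proof -
        have "real M < real n" using M\<delta> that(1) unfolding d_def a_def b_def by linarith
        then show ?thesis using M[OF _ that(2)] by simp
      qed
      show "K * card (near_rational K) + K \<le> card S" using S(3) by simp
      show "\<delta> < y - x" if "x \<in> S" "y \<in> S" "x < y" for x y using elim(2) that by blast
    qed (use S in auto)
    then obtain F0 where F0: "finite F0" "F0 \<subseteq> H" "\<And>F. finite F \<and> F0 \<subseteq> F \<and> F \<subseteq> H \<Longrightarrow>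
      \<bar>LINT x:thick F \<delta>|lborel. - k + 1 * x\<bar> \<le> (2 * e * (2 + 15 * C / K) + C * (5 / K + 2 * (15 * C / K)) + 15 * C / K) * measure lborel (thick F \<delta>)"
      by blast
    show ?case
    proof (intro exI[of _ F0] conjI allI impI F0(1,2))
      fix F assume "finite F \<and> F0 \<subseteq> F \<and> F \<subseteq> H"
      from F0(3)[OF this] show "\<bar>LINT x:thick F \<delta>|lborel. - k + 1 * x\<bar> \<le> \<epsilon> * measure lborel (thick F \<delta>)"
        by (rule order_trans) (rule mult_right_mono[OF const], simp)
    qed
  qed
qed

section \<open>The half-line property\<close>

lemma LINT_affine:
  assumes "bounded A" "A \<in> sets borel"
  shows "(LINT x:A|lborel. u + v * x) = u * measure lborel A + v * (LINT x:A|lborel. x)"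
proof -
  have i: "set_integrable lborel A (\<lambda>x. u)" "set_integrable lborel A (\<lambda>x. x)"
    using affine_set_integrable[OF assms, of u 0] affine_set_integrable[OF assms, of 0 1]
    by (simp_all only: mult_zero_left mult_1_left add_0_left add_0_right)
  have "(LINT x:A|lborel. u + v * x) = (LINT x:A|lborel. u) + (LINT x:A|lborel. v * x)"
    by (rule set_integral_add(2)[OF i(1)]) (use i(2) in simp)
  also have "(LINT x:A|lborel. u) = u * measure lborel A"
    by (simp add: set_lebesgue_integral_def mult.commute)
  finally show ?thesis by simp
qed

lemma LINT_affine_ge:
  assumes A: "bounded A" "A \<in> sets borel" and m: "\<And>x. x \<in> A \<Longrightarrow> m \<le> u + v * x"
  shows "m * measure lborel A \<le> (LINT x:A|lborel. u + v * x)"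
proof -
  have "(LINT x:A|lborel. m + 0 * x) \<le> (LINT x:A|lborel. u + v * x)"
    by (rule set_integral_mono[OF affine_set_integrable[OF A] affine_set_integrable[OF A]]) (use m in simp)
  then show ?thesis by (simp add: LINT_affine[OF A, of m 0, simplified] set_lebesgue_integral_def mult.commute)
qed

lemma measure_thick_le:
  fixes \<delta> :: real
  assumes "finite F" "0 \<le> \<delta>"
  shows "measure lborel (thick F \<delta>) \<le> card F * \<delta>"
proof -
  have "measure lborel (thick F \<delta>) \<le> (\<Sum>x\<in>F. measure lborel {x - \<delta><..x})"
    unfolding thick_def by (rule measure_UNION_le[OF assms(1)]) simp
  then show ?thesis using assms(2) by simp
qed


text \<open>The sign \<open>s\<close> selects the half-line above or below \<open>c\<close>.\<close>

lemma lower_bound_infinite_part: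
  assumes mean: "has_eds_mean H k" and inf: "infinite H" and s: "s = 1 \<or> s = -1" and k: "0 \<le> s * (k - c)"
    and GH: "H \<subseteq> G" and \<epsilon>: "0 < \<epsilon>"
  shows "eventually (\<lambda>\<delta>. \<exists>F0. finite F0 \<and> F0 \<subseteq> G \<and> (\<forall>F. finite F \<and> F0 \<subseteq> F \<and> F \<subseteq> G \<longrightarrow>
    - \<epsilon> * measure lborel (thick F \<delta>) \<le> (LINT x:thick (F \<inter> H) \<delta>|lborel. - (s * c) + s * x))) (at_right 0)"
  using thick_mean[OF mean inf \<epsilon>]
proof eventually_elim
  case (elim \<delta>)
  then obtain F0 where F0: "finite F0" "F0 \<subseteq> H" "\<And>F. finite F \<and> F0 \<subseteq> F \<and> F \<subseteq> H \<Longrightarrow>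
    \<bar>LINT x:thick F \<delta>|lborel. - k + 1 * x\<bar> \<le> \<epsilon> * measure lborel (thick F \<delta>)" by blast
  show ?case
  proof (intro exI[of _ F0] conjI allI impI F0(1))
    show "F0 \<subseteq> G" using F0(2) GH by blast
    fix F assume F: "finite F \<and> F0 \<subseteq> F \<and> F \<subseteq> G"
    define A where "A = thick (F \<inter> H) \<delta>"
    have A: "bounded A" "A \<in> sets borel" unfolding A_def using F by (auto intro: thick_bounded)
    define B where "B = (LINT x:A|lborel. x)"
    define l where "l = measure lborel A"
    \<comment> \<open>The estimate for \<open>H\<close> is applied to the trace of \<open>F\<close>
      on \<open>H\<close>, whose thickening is no larger than that of \<open>F\<close>.\<close>
    have "finite (F \<inter> H) \<and> F0 \<subseteq> F \<inter> H \<and> F \<inter> H \<subseteq> H" using F F0(2) by blast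
    from F0(3)[OF this] have "\<bar>- k * l + 1 * B\<bar> \<le> \<epsilon> * l"
      unfolding A_def[symmetric] LINT_affine[OF A] B_def l_def .
    then have "- \<epsilon> * l \<le> s * (B - k * l)" using s by auto
    moreover have "0 \<le> s * (k - c) * l" using mult_nonneg_nonneg[OF k, of l] unfolding l_def by simp
    \<comment> \<open>The integral of \<open>s * (x - c)\<close> splits into the deviation of the
      barycentre from \<open>k\<close>, which is small, and the contribution of \<open>k\<close>,
      which is nonnegative.\<close>
    moreover have "s * (B - k * l) + s * (k - c) * l = - (s * c) * l + s * B" by (simp add: algebra_simps)
    ultimately have "- \<epsilon> * l \<le> (LINT x:A|lborel. - (s * c) + s * x)"
      unfolding LINT_affine[OF A] B_def[symmetric] l_def[symmetric] by linarith
    moreover have "l \<le> measure lborel (thick F \<delta>)"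
      unfolding l_def by (rule measure_mono_bounded) (use F A in \<open>auto simp: A_def intro: thick_bounded thick_mono[THEN subsetD]\<close>)
    then have "\<epsilon> * l \<le> \<epsilon> * measure lborel (thick F \<delta>)" using \<epsilon> by (intro mult_left_mono) auto
    ultimately show "- \<epsilon> * measure lborel (thick F \<delta>) \<le> (LINT x:thick (F \<inter> H) \<delta>|lborel. - (s * c) + s * x)"
      unfolding A_def by linarith
  qed
qed

text \<open>\<open>H\<close> may be finite although \<open>H \<union> L\<close> is infinite. Then
  its thickening has measure at most \<open>card H * \<delta>\<close>, negligible against that of
  \<open>F\<close>, which exceeds any given multiple of \<open>\<delta>\<close> once
  \<open>F\<close> contains enough separated points of \<open>G\<close>. The mean of
  \<open>H\<close> is irrelevant here.\<close>

lemma lower_bound_finite_part: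
  assumes fin: "finite H" and inf: "infinite G" and s: "s = 1 \<or> s = -1" and \<epsilon>: "0 < \<epsilon>"
  shows "eventually (\<lambda>\<delta>. \<exists>F0. finite F0 \<and> F0 \<subseteq> G \<and> (\<forall>F. finite F \<and> F0 \<subseteq> F \<and> F \<subseteq> G \<longrightarrow>
    - \<epsilon> * measure lborel (thick F \<delta>) \<le> (LINT x:thick (F \<inter> H) \<delta>|lborel. - (s * c) + s * x))) (at_right 0)"
proof -
  obtain b where b: "H \<subseteq> {-b..b}" using bounded_subset_cbox_symmetric[OF finite_imp_bounded[OF fin]] by (metis cbox_interval)
  define M where "M = \<bar>b\<bar> + \<bar>c\<bar> + 1"
  \<comment> \<open>\<open>M\<close> bounds \<open>|x - c|\<close> on the thickening of
    \<open>H\<close>, so \<open>m\<close> separated points outweigh the loss there.\<close>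
  obtain m where m: "M * card H / \<epsilon> \<le> real m" using real_arch_simple by blast
  obtain S where S: "S \<subseteq> G" "finite S" "card S = m" using infinite_arbitrarily_large[OF inf] by blast
  have "eventually (\<lambda>\<delta>. \<delta> \<in> {0<..<1}) (at_right (0::real))" by (rule eventually_at_right_real) simp
  then show ?thesis using eventually_separated[OF S(2)]
  proof eventually_elim
    case (elim \<delta>)
    then have \<delta>: "0 < \<delta>" "\<delta> < 1" by auto
    show ?case
    proof (intro exI[of _ S] conjI allI impI S(1,2))
      fix F assume F: "finite F \<and> S \<subseteq> F \<and> F \<subseteq> G"
      define A where "A = thick (F \<inter> H) \<delta>"
      have A: "bounded A" "A \<in> sets borel" unfolding A_def using F by (auto intro: thick_bounded)
      have Ab: "A \<subseteq> {-b - \<delta>..b}" unfolding A_def by (rule thick_subset) (use b in blast)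
      have "- M \<le> - (s * c) + s * x" if "x \<in> A" for x
      proof -
        have "-b - \<delta> \<le> x" "x \<le> b" using Ab that by auto
        then have "- M \<le> x - c" "- M \<le> c - x" unfolding M_def using \<delta> by linarith+
        then show ?thesis using s by auto
      qed
      then have "- M * measure lborel A \<le> (LINT x:A|lborel. - (s * c) + s * x)"
        by (rule LINT_affine_ge[OF A])
      moreover have "measure lborel A \<le> card H * \<delta>"
      proof -
        have "card (F \<inter> H) \<le> card H" using fin by (intro card_mono) auto
        then have "real (card (F \<inter> H)) * \<delta> \<le> real (card H) * \<delta>" using \<delta> by (intro mult_right_mono) auto
        moreover have "measure lborel A \<le> card (F \<inter> H) * \<delta>"
          unfolding A_def by (rule measure_thick_le) (use F \<delta> in auto)
        ultimately show ?thesis by linarith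
      qed
      then have "M * measure lborel A \<le> M * (card H * \<delta>)" unfolding M_def by (intro mult_left_mono) auto
      moreover have "M * (card H * \<delta>) \<le> \<epsilon> * (card S * \<delta>)"
      proof -
        have "M * card H \<le> \<epsilon> * card S" using m \<epsilon> unfolding S(3) by (simp add: pos_divide_le_eq mult.commute)
        then show ?thesis using mult_right_mono[of "M * card H" "\<epsilon> * card S" \<delta>] \<delta>(1) by (simp add: mult.assoc)
      qed
      moreover have "card S * \<delta> \<le> measure lborel (thick F \<delta>)"
        by (rule measure_thick_ge) (use F \<delta> elim in auto)
      then have "\<epsilon> * (card S * \<delta>) \<le> \<epsilon> * measure lborel (thick F \<delta>)" using \<epsilon> by (intro mult_left_mono) auto
      ultimately show "- \<epsilon> * measure lborel (thick F \<delta>) \<le> (LINT x:thick (F \<inter> H) \<delta>|lborel. - (s * c) + s * x)"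
        unfolding A_def by linarith
    qed
  qed
qed

text \<open>The thickening of \<open>F\<close> is split into that of \<open>F \<inter> H\<close>,
  where the integral of \<open>s * (x - c)\<close> is at least \<open>- \<epsilon>\<close> times the
  total measure, and a rest near \<open>L\<close>, where the integrand is at least
  \<open>- \<delta>\<close>. A mean \<open>k'\<close> on the wrong side of \<open>c\<close> would
  make the total too negative.\<close>

lemma half_line_infinite:
  assumes H: "has_eds_mean H k" and G: "has_eds_mean (H \<union> L) k'" and inf: "infinite (H \<union> L)"
    and s: "s = 1 \<or> s = -1" and k: "0 \<le> s * (k - c)" and L: "\<forall>x\<in>L. 0 \<le> s * (x - c)"
  shows "0 \<le> s * (k' - c)"
proof (rule ccontr)
  assume neg: "\<not> ?thesis"
  \<comment> \<open>Per unit of measure the lower bound is \<open>- 2 * \<epsilon>\<close>, while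
    the mean \<open>k'\<close> allows at most \<open>- 4 * \<epsilon> + \<epsilon>\<close>.\<close>
  define \<epsilon> where "\<epsilon> = - (s * (k' - c)) / 4"
  have \<epsilon>: "0 < \<epsilon>" using neg unfolding \<epsilon>_def by simp
  have "eventually (\<lambda>\<delta>. \<exists>F0. finite F0 \<and> F0 \<subseteq> H \<union> L \<and> (\<forall>F. finite F \<and> F0 \<subseteq> F \<and> F \<subseteq> H \<union> L \<longrightarrow>
    - \<epsilon> * measure lborel (thick F \<delta>) \<le> (LINT x:thick (F \<inter> H) \<delta>|lborel. - (s * c) + s * x))) (at_right 0)"
    using lower_bound_infinite_part[OF H _ s k _ \<epsilon>, of "H \<union> L"] lower_bound_finite_part[OF _ inf s \<epsilon>, of H] by blast
  moreover note thick_mean[OF G inf \<epsilon>]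
  moreover have "eventually (\<lambda>\<delta>. \<delta> \<in> {0<..<\<epsilon>}) (at_right 0)" using \<epsilon> by (rule eventually_at_right_real)
  ultimately have "eventually (\<lambda>\<delta>. False) (at_right (0::real))"
  proof eventually_elim
    case (elim \<delta>)
    then have \<delta>: "0 < \<delta>" "\<delta> < \<epsilon>" by auto
    obtain F1 where F1: "finite F1" "F1 \<subseteq> H \<union> L" "\<And>F. finite F \<and> F1 \<subseteq> F \<and> F \<subseteq> H \<union> L \<Longrightarrow>
      - \<epsilon> * measure lborel (thick F \<delta>) \<le> (LINT x:thick (F \<inter> H) \<delta>|lborel. - (s * c) + s * x)" using elim(1) by blast
    obtain F2 where F2: "finite F2" "F2 \<subseteq> H \<union> L" "\<And>F. finite F \<and> F2 \<subseteq> F \<and> F \<subseteq> H \<union> L \<Longrightarrow>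
      \<bar>LINT x:thick F \<delta>|lborel. - k' + 1 * x\<bar> \<le> \<epsilon> * measure lborel (thick F \<delta>)" using elim(2) by blast
    obtain z where z: "z \<in> H \<union> L" using infinite_imp_nonempty[OF inf] by blast
    \<comment> \<open>The point \<open>z\<close> keeps \<open>F\<close> nonempty, so that its
      thickening has positive measure.\<close>
    define F where "F = insert z (F1 \<union> F2)"
    have F: "finite F" "F \<subseteq> H \<union> L" "F1 \<subseteq> F" "F2 \<subseteq> F" unfolding F_def using F1 F2 z by auto
    define W where "W = thick F \<delta>"
    define A where "A = thick (F \<inter> H) \<delta>"
    \<comment> \<open>Overlaps are assigned to \<open>A\<close>, so a point of \<open>R\<close> is
      covered only by intervals ending in \<open>L\<close>.\<close>
    define R where "R = W - A"
    have A: "bounded A" "A \<in> sets borel" and W: "bounded W" "W \<in> sets borel"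
      unfolding A_def W_def using F(1) by (auto intro: thick_bounded)
    have R: "bounded R" "R \<in> sets borel" unfolding R_def using A W by (auto intro: bounded_diff)
    have "A \<subseteq> W" unfolding A_def W_def by (rule thick_mono) blast
    then have WAR: "W = A \<union> R" "A \<inter> R = {}" unfolding R_def by auto
    define l where "l = measure lborel W"
    have "card {z} * \<delta> \<le> l" unfolding l_def W_def by (rule measure_thick_ge) (use F \<delta> in \<open>auto simp: F_def\<close>)
    then have l: "0 < l" using \<delta>(1) by simp
    have "- \<delta> \<le> - (s * c) + s * y" if y: "y \<in> R" for y
    proof -
      obtain x where x: "x \<in> F" "x \<notin> H" "y \<in> {x - \<delta><..x}" using y unfolding R_def W_def A_def thick_def by blast
      have "x \<in> L" using x F(2) by blast
      then show ?thesis using bspec[OF L, of x] x(3) s \<delta>(1) by auto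
    qed
    then have "- \<delta> * measure lborel R \<le> (LINT x:R|lborel. - (s * c) + s * x)" by (rule LINT_affine_ge[OF R])
    moreover have "\<delta> * measure lborel R \<le> \<epsilon> * l"
      unfolding l_def using \<delta> measure_mono_bounded[OF _ W(1) R(2) W(2)] R_def by (intro mult_mono) auto
    moreover have "- \<epsilon> * l \<le> (LINT x:A|lborel. - (s * c) + s * x)"
      unfolding l_def W_def A_def by (rule F1(3)) (use F in blast)
    moreover have "(LINT x:W|lborel. - (s * c) + s * x) = (LINT x:A|lborel. - (s * c) + s * x) + (LINT x:R|lborel. - (s * c) + s * x)"
      unfolding WAR(1) by (rule LINT_affine_Un[OF A(1) R(1) A(2) R(2) WAR(2)])
    ultimately have 1: "- 2 * (\<epsilon> * l) \<le> - (s * c) * l + s * (LINT x:W|lborel. x)"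
      unfolding LINT_affine[OF W] l_def[symmetric] by linarith
    have "\<bar>LINT x:W|lborel. - k' + 1 * x\<bar> \<le> \<epsilon> * l"
      unfolding l_def W_def by (rule F2(3)) (use F in blast)
    then have "\<bar>- k' * l + (LINT x:W|lborel. x)\<bar> \<le> \<epsilon> * l"
      unfolding LINT_affine[OF W] l_def[symmetric] by simp
    then have 2: "s * ((LINT x:W|lborel. x) - k' * l) \<le> \<epsilon> * l" using s by auto
    have "s * ((LINT x:W|lborel. x) - k' * l) = - (s * c) * l + s * (LINT x:W|lborel. x) - s * (k' - c) * l"
      by (simp add: algebra_simps)
    also have "s * (k' - c) = - 4 * \<epsilon>" unfolding \<epsilon>_def by simp
    finally have "- 2 * (\<epsilon> * l) + 4 * (\<epsilon> * l) \<le> \<epsilon> * l" using 1 2 by simp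
    moreover have "0 < \<epsilon> * l" using \<epsilon> l by simp
    ultimately show False by linarith
  qed
  then show False by (simp add: trivial_limit_at_right_real eventually_False)
qed

section \<open>The half-line property for finite sets\<close>

text \<open>Once the mesh is below the smallest gap, each cell holds at most one point, and the
  half-open cells miss only the maximum. Since the maximum drops out, the barycentres of thickenings
  would in general give a different value, so finite sets need this formula.\<close>

lemma has_eds_mean_finite:
  assumes mean: "has_eds_mean H k" and fin: "finite H"
  shows "k = arith_mean (H - {Sup H})"
proof -
  define a b d where "a = Inf H" and "b = Sup H" and "d = b - a"
  note D = has_eds_meanD[OF mean]
  have d: "0 < d" using D(2) unfolding a_def b_def d_def by simp
  obtain g where g: "0 < g" "\<And>x y. \<lbrakk>x \<in> H; y \<in> H; x < y\<rbrakk> \<Longrightarrow> g < y - x"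
  proof -
    have "eventually (\<lambda>\<delta>. (\<forall>x\<in>H. \<forall>y\<in>H. x < y \<longrightarrow> \<delta> < y - x) \<and> \<delta> \<in> {0<..<1}) (at_right 0)"
      by (intro eventually_conj eventually_separated fin eventually_at_right_real) simp
    then obtain g where "(\<forall>x\<in>H. \<forall>y\<in>H. x < y \<longrightarrow> g < y - x) \<and> g \<in> {0<..<1}"
      using eventually_happens'[OF trivial_limit_at_right_real] by blast
    then show thesis by (intro that[of g]) simp_all
  qed
  have cells: "\<xi> ` eds_index H n = H - {b}"
    if n: "0 < n" "d / n < g" and \<xi>: "\<forall>i\<in>eds_index H n. \<xi> i \<in> eds_cell H n i" for n \<xi>
  proof
    define w where "w = d / n"
    have w: "0 < w" "w < g" "real n * w = d" unfolding w_def using d n by simp_all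
    have cell: "eds_cell H n i = H \<inter> {a + real i * w..<a + real (Suc i) * w}" for i
      unfolding w_def d_def a_def b_def by (rule eds_cell_eq[OF n(1)])
    show "\<xi> ` eds_index H n \<subseteq> H - {b}"
    proof (intro image_subsetI)
      fix i assume i: "i \<in> eds_index H n"
      then have "Suc i \<le> n" unfolding eds_index_def by auto
      then have "real (Suc i) * w \<le> real n * w" using w by (intro mult_right_mono) auto
      then show "\<xi> i \<in> H - {b}" using bspec[OF \<xi> i] w(3) unfolding cell d_def by auto
    qed
    show "H - {b} \<subseteq> \<xi> ` eds_index H n"
    proof
      fix x assume x: "x \<in> H - {b}"
      then have "a \<le> x" "x < b" using D(3,4)[of x] unfolding a_def b_def by auto
      define i where "i = nat \<lfloor>(x - a) / w\<rfloor>"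
      have "0 \<le> (x - a) / w" using \<open>a \<le> x\<close> w by simp
      then have i: "real i \<le> (x - a) / w" "(x - a) / w < real (Suc i)" unfolding i_def by (simp_all, linarith)
      then have xi: "x \<in> eds_cell H n i" unfolding cell using x w by (simp add: pos_le_divide_eq pos_divide_less_eq)
      have "(x - a) / w < real n" using \<open>x < b\<close> w unfolding d_def by (simp add: pos_divide_less_eq)
      then have "i < n" using i by linarith
      then have ii: "i \<in> eds_index H n" unfolding eds_index_def using xi by auto
      then have "\<xi> i \<in> eds_cell H n i" using \<xi> by blast
      then have xx: "\<xi> i \<in> H" "\<bar>\<xi> i - x\<bar> < w" using xi unfolding cell by (auto simp: distrib_right)
      have "\<xi> i = x" using g(2)[OF xx(1), of x] g(2)[of x "\<xi> i"] x xx w(2) by (cases "\<xi> i" x rule: linorder_cases) auto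
      then show "x \<in> \<xi> ` eds_index H n" using ii by blast
    qed
  qed
  have "\<bar>arith_mean (H - {b}) - k\<bar> \<le> 0"
  proof (rule field_le_epsilon)
    fix e :: real assume "0 < e"
    then obtain M :: nat where M: "\<And>n \<xi>. \<lbrakk>M < n; \<forall>i\<in>eds_index H n. \<xi> i \<in> eds_cell H n i\<rbrakk> \<Longrightarrow> \<bar>arith_mean (\<xi> ` eds_index H n) - k\<bar> < e"
      using has_eds_mean_bound[OF mean] by blast
    obtain m :: nat where m: "d / g < m" using reals_Archimedean2 by blast
    \<comment> \<open>Beyond \<open>M\<close> the sample mean is \<open>e\<close>-close to
      \<open>k\<close>; beyond \<open>d / g\<close> the cells separate the points.\<close>
    define n where "n = max m (M + 1)"
    have "d / g < n" using m unfolding n_def by linarith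
    then have n: "0 < n" "d / n < g" "M < n" using d g(1) unfolding n_def by (simp_all add: pos_divide_less_eq mult.commute)
    define \<xi> where "\<xi> i = (SOME x. x \<in> eds_cell H n i)" for i
    have \<xi>: "\<forall>i\<in>eds_index H n. \<xi> i \<in> eds_cell H n i"
      unfolding \<xi>_def eds_index_def by (auto simp: some_in_eq)
    show "\<bar>arith_mean (H - {b}) - k\<bar> \<le> 0 + e" using M[OF n(3) \<xi>] cells[OF n(1,2) \<xi>] by simp
  qed
  then show ?thesis unfolding b_def by simp
qed

text \<open>The inequality is equivalent to nonnegativity of the sum of \<open>s * (x - c)\<close>.
  Passing from \<open>A\<close> to \<open>B\<close> adds points of \<open>L\<close> and possibly
  \<open>Sup H\<close>, which stops being dropped when \<open>L\<close> contains a larger point. All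
  added terms are nonnegative.\<close>

lemma half_line_finite:
  assumes H: "has_eds_mean H k" and G: "has_eds_mean (H \<union> L) k'" and fin: "finite (H \<union> L)"
    and s: "s = 1 \<or> s = -1" and k: "0 \<le> s * (k - c)" and L: "\<forall>x\<in>L. 0 \<le> s * (x - c)"
  shows "0 \<le> s * (k' - c)"
proof -
  note DH = has_eds_meanD[OF H] and DG = has_eds_meanD[OF G]
  have sum_iff: "0 \<le> s * (arith_mean A - c) \<longleftrightarrow> 0 \<le> (\<Sum>x\<in>A. s * (x - c))" if "finite A" "A \<noteq> {}" for A
  proof -
    have cA: "0 < real (card A)" using that by (simp add: card_gt_0_iff)
    have "(\<Sum>x\<in>A. s * (x - c)) = s * ((\<Sum>x\<in>A. x) - card A * c)"
      by (simp add: sum_distrib_left[symmetric] sum_subtractf)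
    also have "\<dots> = card A * (s * (arith_mean A - c))" unfolding arith_mean_def using cA by (simp add: field_simps)
    finally show ?thesis using cA by (simp add: zero_le_mult_iff)
  qed
  have Inf: "Inf A \<in> A - {Sup A}" if "has_eds_mean A j" "finite A" for A j
  proof -
    note D = has_eds_meanD[OF that(1)]
    have "A \<noteq> {}" using that(1) unfolding has_eds_mean_def by blast
    then show ?thesis using D(2) cInf_eq_Min[OF that(2)] Min_in[OF that(2)] by auto
  qed
  have Sup: "Sup A \<in> A" if "has_eds_mean A j" "finite A" for A j
  proof -
    have "A \<noteq> {}" using that(1) unfolding has_eds_mean_def by blast
    then show ?thesis using cSup_eq_Max[OF that(2)] Max_in[OF that(2)] by auto
  qed
  have fH: "finite H" using fin by simp
  define A B where "A = H - {Sup H}" and "B = (H \<union> L) - {Sup (H \<union> L)}"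
  have AB: "finite A" "A \<noteq> {}" "finite B" "B \<noteq> {}"
    unfolding A_def B_def using fin Inf[OF H fH] Inf[OF G fin] by auto
  have kA: "k = arith_mean A" and kB: "k' = arith_mean B"
    unfolding A_def B_def by (rule has_eds_mean_finite[OF H fH], rule has_eds_mean_finite[OF G fin])
  have SH: "Sup H \<in> H" and SG: "Sup (H \<union> L) \<in> H \<union> L" using Sup[OF H fH] Sup[OF G fin] .
  have SHG: "Sup H \<le> Sup (H \<union> L)" using DG(4) SH by blast
  have "A \<subseteq> B"
  proof
    fix x assume "x \<in> A"
    then have "x \<in> H" "x < Sup H" using DH(4)[of x] unfolding A_def by auto
    then show "x \<in> B" using SHG unfolding B_def by auto
  qed
  have kH: "k \<le> Sup H"
  proof -
    have "(\<Sum>x\<in>A. x) \<le> card A * Sup H"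
      by (rule sum_bounded_above) (use DH(4) A_def in auto)
    then show ?thesis unfolding kA arith_mean_def using AB(1,2) by (simp add: pos_divide_le_eq card_gt_0_iff mult.commute)
  qed
  have rest: "0 \<le> s * (x - c)" if x: "x \<in> B - A" for x
  proof (cases "x \<in> L")
    case True
    then show ?thesis using L by blast
  next
    case False
    \<comment> \<open>For \<open>s = 1\<close> the point \<open>Sup H\<close> is on the right side
      of \<open>c\<close> because \<open>k \<le> Sup H\<close>; for \<open>s = -1\<close> because
      the new maximum belongs to \<open>L\<close> and exceeds it.\<close>
    then have xH: "x = Sup H" and "x \<noteq> Sup (H \<union> L)" using x unfolding A_def B_def by auto
    then have lt: "Sup H < Sup (H \<union> L)" using SHG by simp
    then have "Sup (H \<union> L) \<notin> H" using DH(4) by force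
    then have "0 \<le> s * (Sup (H \<union> L) - c)" using SG L by blast
    then show ?thesis using s kH k lt unfolding xH by auto
  qed
  have "(\<Sum>x\<in>B. s * (x - c)) = (\<Sum>x\<in>B - A. s * (x - c)) + (\<Sum>x\<in>A. s * (x - c))"
    by (rule sum.subset_diff[OF \<open>A \<subseteq> B\<close> AB(3)])
  moreover have "0 \<le> (\<Sum>x\<in>B - A. s * (x - c))" using rest by (rule sum_nonneg)
  moreover have "0 \<le> (\<Sum>x\<in>A. s * (x - c))" using k sum_iff[OF AB(1,2)] unfolding kA by simp
  ultimately have "0 \<le> (\<Sum>x\<in>B. s * (x - c))" by (simp only: add_nonneg_nonneg)
  then show ?thesis unfolding kB by (rule sum_iff[OF AB(3,4), THEN iffD2])
qed

text \<open>The signs 1 and -1 give lower and upper bounds for the new mean, and empty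
  \<open>L\<close> gives uniqueness.\<close>

lemma eds_half_line:
  assumes "has_eds_mean H k" "has_eds_mean (H \<union> L) k'"
    and "s = 1 \<or> s = -1" "0 \<le> s * (k - c)" "\<forall>x\<in>L. 0 \<le> s * (x - c)"
  shows "0 \<le> s * (k' - c)"
proof (cases "finite (H \<union> L)")
  case True
  then show ?thesis by (rule half_line_finite[OF assms(1,2) _ assms(3-5)])
next
  case False
  then show ?thesis by (rule half_line_infinite[OF assms(1,2) _ assms(3-5)])
qed

section \<open>Uniqueness of the mean, monotonicity and convexity\<close>

lemma has_eds_mean_between:
  assumes mean: "has_eds_mean H k"
  shows "Inf H \<le> k" "k \<le> Sup H"
proof -
  note D = has_eds_meanD[OF mean]
  have "Inf H \<le> k + e \<and> k \<le> Sup H + e" if e: "0 < e" for e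
  proof -
    obtain M :: nat where M: "\<And>n \<xi>. \<lbrakk>M < n; \<forall>i\<in>eds_index H n. \<xi> i \<in> eds_cell H n i\<rbrakk> \<Longrightarrow> \<bar>arith_mean (\<xi> ` eds_index H n) - k\<bar> < e"
      using has_eds_mean_bound[OF mean e] by blast
    define n where "n = Suc M"
    define \<xi> where "\<xi> i = (SOME x. x \<in> eds_cell H n i)" for i
    have \<xi>: "\<forall>i\<in>eds_index H n. \<xi> i \<in> eds_cell H n i"
      unfolding \<xi>_def eds_index_def by (auto simp: some_in_eq)
    define A where "A = \<xi> ` eds_index H n"
    have "A \<subseteq> H" unfolding A_def using \<xi> unfolding eds_cell_def by blast
    then have AH: "x \<in> {Inf H..Sup H}" if "x \<in> A" for x using D(3,4) that by auto
    have w: "0 < (Sup H - Inf H) / n" unfolding n_def using D(2) by simp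
    have "H \<noteq> {}" using mean unfolding has_eds_mean_def by blast
    \<comment> \<open>Points of \<open>H\<close> come arbitrarily close to \<open>Inf H\<close>, so
      cell 0 is occupied and the sample mean is not an average over the empty set.\<close>
    then obtain x where "x \<in> H" "x < Inf H + (Sup H - Inf H) / n"
      using cInf_lessD[of H "Inf H + (Sup H - Inf H) / n"] w by auto
    then have "x \<in> eds_cell H n 0" using D(3)[of x] unfolding eds_cell_def by simp
    then have "0 \<in> eds_index H n" unfolding eds_index_def n_def by auto
    then have "0 < card A" unfolding A_def using eds_index_finite[of H n] by (auto simp: card_gt_0_iff)
    moreover have "card A * Inf H \<le> (\<Sum>x\<in>A. x)" "(\<Sum>x\<in>A. x) \<le> card A * Sup H"
      by (rule sum_bounded_below, use AH in simp) (rule sum_bounded_above, use AH in simp)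
    ultimately have "Inf H \<le> arith_mean A" "arith_mean A \<le> Sup H"
      unfolding arith_mean_def by (simp_all add: pos_le_divide_eq pos_divide_le_eq mult.commute)
    moreover have "\<bar>arith_mean A - k\<bar> < e" unfolding A_def by (rule M[OF _ \<xi>]) (simp add: n_def)
    ultimately show ?thesis by linarith
  qed
  then show "Inf H \<le> k" "k \<le> Sup H" by (blast intro: field_le_epsilon)+
qed

text \<open>This is the half-line property with empty \<open>L\<close> and \<open>c = k\<close>. By
  symmetry the mean is unique, which justifies the definite description in
  \<open>eds_mean\<close>.\<close>

lemma has_eds_mean_le:
  assumes "has_eds_mean H k" "has_eds_mean H k'"
  shows "k \<le> k'"
  using eds_half_line[of H k "{}" k' 1 k] assms by simp

lemma eds_mean_eq: "has_eds_mean H k \<Longrightarrow> eds_mean H = k"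
  unfolding eds_mean_def by (rule the_equality) (auto intro: antisym has_eds_mean_le)

lemma has_eds_mean_Dom: "H \<in> Dom_eds \<Longrightarrow> has_eds_mean H (eds_mean H)"
  unfolding Dom_eds_def using eds_mean_eq by auto

lemma eds_mean_ge:
  assumes "H \<in> Dom_eds" "H \<union> L \<in> Dom_eds" "c \<le> eds_mean H" "\<And>x. x \<in> L \<Longrightarrow> c \<le> x"
  shows "c \<le> eds_mean (H \<union> L)"
  using eds_half_line[OF assms(1,2)[THEN has_eds_mean_Dom], of 1 c] assms(3,4) by simp

lemma eds_mean_le:
  assumes "H \<in> Dom_eds" "H \<union> L \<in> Dom_eds" "eds_mean H \<le> c" "\<And>x. x \<in> L \<Longrightarrow> x \<le> c"
  shows "eds_mean (H \<union> L) \<le> c"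
  using eds_half_line[OF assms(1,2)[THEN has_eds_mean_Dom], of "-1" c] assms(3,4) by simp

theorem proposition6p6:
  shows "monotone_mean Dom_eds eds_mean \<and> convex_mean Dom_eds eds_mean"
proof
  show "monotone_mean Dom_eds eds_mean"
    unfolding monotone_mean_def
  proof (intro allI impI)
    fix H1 H2 assume "H1 \<in> Dom_eds \<and> H2 \<in> Dom_eds \<and> H1 \<union> H2 \<in> Dom_eds \<and> Sup H1 \<le> Inf H2"
    then have D: "H1 \<in> Dom_eds" "H2 \<in> Dom_eds" "H1 \<union> H2 \<in> Dom_eds" and le: "Sup H1 \<le> Inf H2" by auto
    note m1 = has_eds_mean_Dom[OF D(1)] and m2 = has_eds_mean_Dom[OF D(2)]
    \<comment> \<open>The half-line starts at the mean of \<open>H1\<close> itself; it contains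
      \<open>H2\<close>, since that mean is at most \<open>Sup H1 \<le> Inf H2\<close>.\<close>
    have "eds_mean H1 \<le> eds_mean (H1 \<union> H2)"
      using eds_mean_ge[OF D(1,3) order_refl] has_eds_mean_between(2)[OF m1] le has_eds_meanD(3)[OF m2] by force
    moreover have "eds_mean (H2 \<union> H1) \<le> eds_mean H2"
      using eds_mean_le[OF D(2) _ order_refl, of H1] D(3) has_eds_mean_between(1)[OF m2] le has_eds_meanD(4)[OF m1]
      by (force simp: Un_commute)
    ultimately show "eds_mean H1 \<le> eds_mean (H1 \<union> H2) \<and> eds_mean (H1 \<union> H2) \<le> eds_mean H2"
      by (simp add: Un_commute)
  qed
  show "convex_mean Dom_eds eds_mean"
    unfolding convex_mean_def
  proof (intro allI impI)
    fix I :: "real set" and H L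
    assume "is_interval I \<and> closed I \<and> H \<in> Dom_eds \<and> eds_mean H \<in> I \<and> L \<subseteq> I \<and> H \<union> L \<in> Dom_eds"
    then have I: "is_interval I" "closed I" "eds_mean H \<in> I" "L \<subseteq> I" and D: "H \<in> Dom_eds" "H \<union> L \<in> Dom_eds" by auto
    have ne: "I \<noteq> {}" using I(3) by blast
    \<comment> \<open>It suffices to find points of \<open>I\<close> on both sides of the new mean.
      A finite end lies in the closed set \<open>I\<close> and is handled by the half-line property;
      on an unbounded side such a point exists in any case.\<close>
    have "\<exists>x\<in>I. x \<le> eds_mean (H \<union> L)"
    proof (cases "bdd_below I")
      case True
      have "Inf I \<le> eds_mean (H \<union> L)"
        by (rule eds_mean_ge[OF D]) (use I(3,4) cInf_lower[OF _ True] in auto)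
      then show ?thesis using closed_contains_Inf[OF ne True I(2)] by blast
    next
      case False
      then show ?thesis unfolding bdd_below_def by (meson linear)
    qed
    moreover have "\<exists>x\<in>I. eds_mean (H \<union> L) \<le> x"
    proof (cases "bdd_above I")
      case True
      have "eds_mean (H \<union> L) \<le> Sup I"
        by (rule eds_mean_le[OF D]) (use I(3,4) cSup_upper[OF _ True] in auto)
      then show ?thesis using closed_contains_Sup[OF ne True I(2)] by blast
    next
      case False
      then show ?thesis unfolding bdd_above_def by (meson linear)
    qed
    ultimately show "eds_mean (H \<union> L) \<in> I" using I(1) unfolding is_interval_1 by blast
  qed
qed

end
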